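(* Let $\mathcal{C}$ be a covering of the plane by complete folding curves which satisfies the local isomorphism property. Then $\mathcal{C}$ is locally isomorphic to a covering (by complete folding curves, satisfying the local isomorphism property) generated by a curve associated to an $\infty$-folding sequence.
   Context: Curves and coverings. Identify $\mathbb{R}^2$ with $\mathbb{C}$ and $\mathbb{Z}^2$ with $\mathbb{Z}+i\mathbb{Z}$. To a sequence $(a_k)_{1\le k\le n-1}$, $(a_k)_{k\in\mathbb{N}^*}$ or $(a_k)_{k\in\mathbb{Z}}$ with all $a_k=\pm1$ are associated the curves $(C_k)_{1\le k\le n}$, $(C_k)_{k\in\mathbb{N}^*}$, $(C_k)_{k\in\mathbb{Z}}$ whose segments are oriented intervals $C_k=[x_k,x_k+\varepsilon_k]$ with $x_k\in\mathbb{Z}+i\mathbb{Z}$, $\varepsilon_k\in\{1,-1,i,-i\}$, and, whenever $C_k,C_{k+1}$ exist, $x_k+\varepsilon_k=x_{k+1}$ and $\varepsilon_{k+1}=i^{a_k}\varepsilon_k$. Curves are rounded at the points $x_{k+1}$ so that they do not pass through them (so curves sharing no unit interval are disjoint). Curves indexed by $\mathbb{Z}$ are called complete and are considered up to a shift of the index. A covering (of the plane) is a set of complete curves such that each nonoriented interval $[z,z+\varepsilon]$ with $z\in\mathbb{Z}+i\mathbb{Z}$, $\varepsilon\in\{1,i\}$ is the support of exactly one segment of exactly one of the curves. Orientation convention: for each $z=x+iy\in\mathbb{Z}+i\mathbb{Z}$, depending on the parity of $x+y$, the segments with endpoint $z$ are $[z,z+1],[z,z-1],[z+i,z],[z-i,z]$,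 or they are $[z+1,z],[z-1,z],[z,z+i],[z,z-i]$. Folding sequences. For a finite sequence $S=(a_1,\dots,a_m)$ put $\overline{S}=(-a_m,\dots,-a_1)$. The $0$-folding sequence is empty, and the $(n+1)$-folding sequences are the sequences $(\overline{S},\varepsilon,S)$ with $S$ an $n$-folding sequence and $\varepsilon=\pm1$. An $\infty$-folding sequence is a sequence $S=(a_k)_{k\in\mathbb{N}^*}$ such that $(a_1,\dots,a_{2^n-1})$ is an $n$-folding sequence for every $n$. A complete folding sequence is a sequence $(a_k)_{k\in\mathbb{Z}}$ in $\{\pm1\}$ such that each finite block $(a_{k+1},\dots,a_{k+l})$ is a block of consecutive terms of an $n$-folding sequence for some $n$. $\infty$-folding curves and complete folding curves are the curves associated to such sequences. Local isomorphism. For sets of curves $\mathcal{B},\mathcal{C}$: $\mathcal{B}\cong\mathcal{C}$ means that $\mathcal{C}$ is the image of $\mathcal{B}$ under a translation; $\mathcal{B}<\mathcal{C}$ means that $\mathcal{B}\ne\mathcal{C}$, each curve of $\mathcal{B}$ is contained in (is a subcurve of) a curve of $\mathcal{C}$, and any consecutive segments of a curve of $\mathcal{C}$ which belong to curves of $\mathcal{B}$ are consecutive in one of them. A covering $\mathcal{C}$ satisfies the local isomorphism property if for each bounded set of curves (finitely many segments) $\mathcal{B}<\mathcal{C}$ there is $r>0$ such that every disc of radius $r$ contains some $\mathcal{B}'<\mathcal{C}$ with $\mathcal{B}'\cong\mathcal{B}$. Coverings $\mathcal{C},\mathcal{D}$ are locally isomorphic if for each bounded $\mathcal{B}<\mathcal{C}$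 there is $\mathcal{B}'<\mathcal{D}$ with $\mathcal{B}'\cong\mathcal{B}$, and conversely with $\mathcal{C}$ and $\mathcal{D}$ exchanged. Generation. A covering $\mathcal{D}$ by complete folding curves which satisfies the local isomorphism property is generated by an $\infty$-folding curve $D$ with initial point $x$ if, up to reversal of orientation, the four curves obtained from $D$ by the rotations of angles $0,\pi/2,\pi,3\pi/2$ around $x$ are subcurves of curves of $\mathcal{D}$ (they are then connected at $x$ into two complete curves of $\mathcal{D}$). *)

theory Defs
  imports "HOL-Analysis.Analysis" "HOL-Library.Sublist"
begin

definition bar :: "int list \<Rightarrow> int list" where
  "bar S = rev (map uminus S)"

inductive folding :: "nat \<Rightarrow> int list \<Rightarrow> bool" where
  folding_0: "folding 0 []"
| folding_Suc: "folding n S \<Longrightarrow> e \<in> {1, -1} \<Longrightarrow> folding (Suc n) (bar S @ e # S)"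

text \<open>All infinite sequences have type \<open>int \<Rightarrow> int\<close>; for a sequence indexed by the positive
  integers the values at indices \<open>\<le> 0\<close> are irrelevant.\<close>

definition infinity_folding :: "(int \<Rightarrow> int) \<Rightarrow> bool" where
  "infinity_folding a \<longleftrightarrow> (\<forall>n. folding n (map a [1..2 ^ n - 1]))"

definition complete_folding :: "(int \<Rightarrow> int) \<Rightarrow> bool" where
  "complete_folding a \<longleftrightarrow> (\<forall>k. a k \<in> {1, -1}) \<and>
     (\<forall>(k::int) (l::nat). \<exists>n S. folding n S \<and> sublist (map a [k + 1..k + int l]) S)"

definition gauss_ints :: "complex set" where
  "gauss_ints = {z. Re z \<in> \<int> \<and> Im z \<in> \<int>}"

text \<open>The pair \<open>(x, e)\<close> is the interval from \<open>x\<close> to \<open>x + e\<close>, oriented from \<open>x\<close> to \<open>x + e\<close>.\<close>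

type_synonym oseg = "complex \<times> complex"

definition support :: "oseg \<Rightarrow> complex set" where
  "support s = closed_segment (fst s) (fst s + snd s)"

definition oseg_reverse :: "oseg \<Rightarrow> oseg" where
  "oseg_reverse s = (fst s + snd s, - snd s)"

text \<open>A curve is the partial function sending each index to the corresponding segment; its domain
  is the index set. Rounding the corners only serves to make curves without a common segment
  disjoint as point sets; it carries no additional data, so it is not represented.\<close>

type_synonym curve = "int \<Rightarrow> oseg option"

definition curve_of :: "int set \<Rightarrow> (int \<Rightarrow> int) \<Rightarrow> curve \<Rightarrow> bool" where
  "curve_of I a C \<longleftrightarrow> dom C = I \<and>
     (\<forall>k. k \<in> I \<and> k + 1 \<in> I \<longrightarrow> a k \<in> {1, -1}) \<and>
     (\<forall>k x e. C k = Some (x, e) \<longrightarrow> x \<in> gauss_ints \<and> e \<in> {1, -1, \<i>, -\<i>}) \<and>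
     (\<forall>k x e x' e'. C k = Some (x, e) \<and> C (k + 1) = Some (x', e') \<longrightarrow>
        x + e = x' \<and> e' = \<i> powi (a k) * e)"

definition is_curve :: "curve \<Rightarrow> bool" where
  "is_curve C \<longleftrightarrow> (\<exists>I a. ((\<exists>n\<ge>1. I = {1..n}) \<or> I = {1..} \<or> I = UNIV) \<and> curve_of I a C)"

definition complete_curve :: "curve \<Rightarrow> bool" where
  "complete_curve C \<longleftrightarrow> (\<exists>a. curve_of UNIV a C)"

definition infinity_folding_curve :: "curve \<Rightarrow> bool" where
  "infinity_folding_curve C \<longleftrightarrow> (\<exists>a. infinity_folding a \<and> curve_of {1..} a C)"

definition complete_folding_curve :: "curve \<Rightarrow> bool" where
  "complete_folding_curve C \<longleftrightarrow> (\<exists>a. complete_folding a \<and> curve_of UNIV a C)"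

definition shift_class :: "curve \<Rightarrow> curve set" where
  "shift_class C = {B. \<exists>m. \<forall>k. B k = C (k + m)}"

text \<open>Equality of sets of curves, where curves are considered up to a shift of the index.\<close>

definition same_curves :: "curve set \<Rightarrow> curve set \<Rightarrow> bool" where
  "same_curves \<B> \<C> \<longleftrightarrow> shift_class ` \<B> = shift_class ` \<C>"

definition subcurve :: "curve \<Rightarrow> curve \<Rightarrow> bool" where
  "subcurve B C \<longleftrightarrow> (\<exists>m. \<forall>k \<in> dom B. C (k + m) = B k)"

definition segments :: "curve set \<Rightarrow> oseg set" where
  "segments \<C> = (\<Union>C\<in>\<C>. ran C)"

definition translate_curve :: "complex \<Rightarrow> curve \<Rightarrow> curve" where
  "translate_curve v C = (\<lambda>k. map_option (\<lambda>(x, e). (x + v, e)) (C k))"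

text \<open>Rotation about \<open>x\<close> by the angle \<open>j \<pi> / 2\<close>.\<close>

definition rotate_curve :: "nat \<Rightarrow> complex \<Rightarrow> curve \<Rightarrow> curve" where
  "rotate_curve j x C = (\<lambda>k. map_option (\<lambda>(y, e). (x + \<i> ^ j * (y - x), \<i> ^ j * e)) (C k))"

definition reverse_curve :: "curve \<Rightarrow> curve" where
  "reverse_curve C = (\<lambda>k. map_option oseg_reverse (C (- k)))"

definition horizontal_out :: "complex \<Rightarrow> oseg set" where
  "horizontal_out z = {(z, 1), (z, -1), (z + \<i>, -\<i>), (z - \<i>, \<i>)}"

definition vertical_out :: "complex \<Rightarrow> oseg set" where
  "vertical_out z = {(z + 1, -1), (z - 1, 1), (z, \<i>), (z, -\<i>)}"

definition orientation_convention :: "curve set \<Rightarrow> bool" where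
  "orientation_convention \<C> \<longleftrightarrow> (\<exists>b::bool. \<forall>x y::int. let z = of_int x + \<i> * of_int y in
     {s \<in> segments \<C>. fst s = z \<or> fst s + snd s = z} =
       (if even (x + y) = b then horizontal_out z else vertical_out z))"

text \<open>Complete curves matter only up to a shift of the index. The uniqueness of the pair
  \<open>(C, k)\<close> below forces a covering to contain exactly one parametrization of each of its
  curves.\<close>

definition covering :: "curve set \<Rightarrow> bool" where
  "covering \<C> \<longleftrightarrow> (\<forall>C\<in>\<C>. complete_curve C) \<and>
     (\<forall>z\<in>gauss_ints. \<forall>e\<in>{1, \<i>}. \<exists>!(C, k). C \<in> \<C> \<and>
        (\<exists>s. C k = Some s \<and> support s = closed_segment z (z + e))) \<and>
     orientation_convention \<C>"

definition cong_curves :: "curve set \<Rightarrow> curve set \<Rightarrow> bool" where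
  "cong_curves \<B> \<C> \<longleftrightarrow> (\<exists>v. same_curves (translate_curve v ` \<B>) \<C>)"

definition less_curves :: "curve set \<Rightarrow> curve set \<Rightarrow> bool" where
  "less_curves \<B> \<C> \<longleftrightarrow> \<not> same_curves \<B> \<C> \<and>
     (\<forall>B\<in>\<B>. \<exists>C\<in>\<C>. subcurve B C) \<and>
     (\<forall>C\<in>\<C>. \<forall>i j. i \<le> j \<and> (\<forall>k\<in>{i..j}. \<exists>s\<in>segments \<B>. C k = Some s) \<longrightarrow>
        (\<exists>B\<in>\<B>. \<exists>m. \<forall>k\<in>{i..j}. B (k + m) = C k))"

definition bounded_curves :: "curve set \<Rightarrow> bool" where
  "bounded_curves \<B> \<longleftrightarrow> finite \<B> \<and> (\<forall>B\<in>\<B>. is_curve B \<and> finite (dom B))"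

definition contained_in :: "curve set \<Rightarrow> complex set \<Rightarrow> bool" where
  "contained_in \<B> X \<longleftrightarrow> (\<forall>s\<in>segments \<B>. support s \<subseteq> X)"

definition local_isomorphism_property :: "curve set \<Rightarrow> bool" where
  "local_isomorphism_property \<C> \<longleftrightarrow>
     (\<forall>\<B>. bounded_curves \<B> \<and> less_curves \<B> \<C> \<longrightarrow>
        (\<exists>r>0. \<forall>w. \<exists>\<B>'. less_curves \<B>' \<C> \<and> cong_curves \<B> \<B>' \<and> contained_in \<B>' (cball w r)))"

definition locally_isomorphic :: "curve set \<Rightarrow> curve set \<Rightarrow> bool" where
  "locally_isomorphic \<C> \<D> \<longleftrightarrow>
     (\<forall>\<B>. bounded_curves \<B> \<and> less_curves \<B> \<C> \<longrightarrow>
        (\<exists>\<B>'. less_curves \<B>' \<D> \<and> cong_curves \<B> \<B>')) \<and>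
     (\<forall>\<B>. bounded_curves \<B> \<and> less_curves \<B> \<D> \<longrightarrow>
        (\<exists>\<B>'. less_curves \<B>' \<C> \<and> cong_curves \<B> \<B>'))"

definition folding_covering :: "curve set \<Rightarrow> bool" where
  "folding_covering \<C> \<longleftrightarrow> covering \<C> \<and> (\<forall>C\<in>\<C>. complete_folding_curve C) \<and>
     local_isomorphism_property \<C>"

text \<open>Reversal is allowed for each of the four curves separately: all four start at \<open>x\<close>, while
  the orientation convention lets only two segments of \<open>\<D>\<close> start there.\<close>

definition generated_by :: "curve set \<Rightarrow> curve \<Rightarrow> bool" where
  "generated_by \<D> D \<longleftrightarrow> folding_covering \<D> \<and> infinity_folding_curve D \<and>
     (\<exists>x e. D 1 = Some (x, e) \<and>
        (\<forall>j<4. \<exists>C\<in>\<D>. subcurve (rotate_curve j x D) C \<or> subcurve (reverse_curve (rotate_curve j x D)) C))"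

end

theory Submission
  imports Defs
begin

text \<open>
  A complete folding sequence contains, for every \<open>n\<close>, a block
  \<open>bar S, u, S, t, bar S, t, S, t, bar S, v, S\<close> with \<open>S\<close> an \<open>n\<close>-folding sequence. Between
  \<open>u\<close> and \<open>v\<close> the curve runs through four copies of one stroke, each turned by a quarter
  turn against the previous one, so it returns to the vertex \<open>x\<close> where it turned by \<open>u\<close>.
  The two passages through \<open>x\<close> use the four edges at \<open>x\<close>, and each of the four half-curves
  leaving \<open>x\<close> has the turns \<open>S\<close> as long as \<open>S\<close> lasts. Translating \<open>x\<close> to the origin and letting
  \<open>n\<close> tend to infinity, a compactness argument gives a limit covering in which four rotated
  copies of one \<open>\<infinity>\<close>-folding curve leave the origin. The bounded patterns of the limit occur in
  the given covering; conversely, by the local isomorphism property, every bounded pattern of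
  the given covering occurs in all discs of some fixed radius, and hence also in the limit.
\<close>

section \<open>Folding sequences\<close>

text \<open>The turns \<open>S n\<close> found for different \<open>n\<close> need not extend one
  another, so no single point of the given covering has to carry a whole \<infinity>-folding curve.
  Passing to a limit supplies the coherence: an orbit of the limit shares each of its initial
  stretches with walks along \<open>S m\<close> for arbitrarily large \<open>m\<close>, and the
  first \<open>2 ^ n - 1\<close> terms of an \<open>m\<close>-folding sequence with
  \<open>n \<le> m\<close> form an \<open>n\<close>-folding sequence. Limits of coverings themselves
  are awkward, since a covering fixes one parametrization of each curve and a curve is an infinite
  object. The successor map of segments avoids this: a segment has only two conceivable successors,
  which gives compactness, and the closed orbits that would spoil a limit are excluded by conditions
  on finite paths. The turns \<open>u\<close> and \<open>v\<close> at the meeting point are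
  arbitrary. The three equal turns between the strokes close the path; that all four edges at the
  point are then used follows from the covering condition.\<close>

lemma length_bar [simp]: "length (bar S) = length S"
  by (simp add: bar_def)

lemma bar_bar [simp]: "bar (bar S) = S"
  by (simp add: bar_def rev_map o_def)

lemma bar_Nil [simp]: "bar [] = []"
  by (simp add: bar_def)

lemma bar_Cons [simp]: "bar (e # S) = bar S @ [- e]"
  by (simp add: bar_def)

lemma bar_append [simp]: "bar (S @ R) = bar R @ bar S"
  by (simp add: bar_def)

lemma nth_bar: "i < length S \<Longrightarrow> bar S ! i = - S ! (length S - Suc i)"
  by (simp add: bar_def rev_nth)

lemma suffix_bar_iff [simp]: "suffix (bar S) (bar R) \<longleftrightarrow> prefix S R"
proof
  assume "suffix (bar S) (bar R)"
  then obtain Q where "bar R = Q @ bar S"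
    by (auto simp: suffix_def)
  then have "R = S @ bar Q"
    by (metis bar_append bar_bar)
  then show "prefix S R"
    by simp
qed (auto simp: prefix_def suffix_def)

lemma sublist_bar_iff [simp]: "sublist (bar S) (bar R) \<longleftrightarrow> sublist S R"
proof -
  have "sublist (bar S) (bar R)" if "sublist S R" for S R
    using that by (auto simp: sublist_def) (metis append.assoc)
  then show ?thesis
    by (metis bar_bar)
qed

lemma folding_Suc_iff: "folding (Suc n) T \<longleftrightarrow> (\<exists>S e. folding n S \<and> e \<in> {1, -1} \<and> T = bar S @ e # S)"
  by (subst folding.simps) auto

lemma folding_0_iff [simp]: "folding 0 T \<longleftrightarrow> T = []"
  by (subst folding.simps) auto

lemma length_folding: "folding n S \<Longrightarrow> length S = 2 ^ n - 1"
proof (induction rule: folding.induct)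
  case (folding_Suc n S e)
  moreover have "(1::nat) \<le> 2 ^ n"
    by simp
  ultimately show ?case
    by simp
qed simp

lemma folding_bar: "folding n S \<Longrightarrow> folding n (bar S)"
proof (induction rule: folding.induct)
  case (folding_Suc n S e)
  then show ?case
    using folding.folding_Suc[of n S "- e"] by auto
qed simp

lemma folding_suffix:
  assumes "folding n T" "m \<le> n"
  shows "\<exists>S. folding m S \<and> suffix S T"
  using assms
proof (induction rule: folding.induct)
  case (folding_Suc n S e)
  show ?case
  proof (cases "m = Suc n")
    case True
    then show ?thesis
      using folding_Suc folding.folding_Suc by blast
  next
    case False
    then obtain R where "folding m R" "suffix R S"
      using folding_Suc by auto
    then show ?thesis
      using suffix_appendI suffix_ConsI by meson
  qed
qed auto

lemma folding_prefix:
  assumes "folding n T" "m \<le> n"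
  shows "\<exists>S. folding m S \<and> prefix S T"
  by (metis assms folding_bar folding_suffix bar_bar suffix_bar_iff)

lemma folding_take:
  assumes "folding n T" "m \<le> n"
  shows "folding m (take (2 ^ m - 1) T)"
  using folding_prefix[OF assms] length_folding by (auto simp: prefix_def)

lemma folding_prefix_of_prefix:
  assumes "folding n T" "prefix w T" "2 ^ m - 1 \<le> length w"
  shows "\<exists>S. folding m S \<and> prefix S w"
proof -
  have "length w \<le> length T"
    using assms(2) by (simp add: prefix_length_le)
  then have "(2::nat) ^ m - 1 \<le> 2 ^ n - 1"
    using assms length_folding by fastforce
  then have "(2::nat) ^ m \<le> 2 ^ n"
    by (metis one_le_numeral one_le_power le_diff_iff)
  then have "m \<le> n"
    by simp
  then obtain S where "folding m S" "prefix S T"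
    using folding_prefix assms(1) by blast
  then show ?thesis
    using assms(2,3) prefix_length_prefix length_folding by metis
qed

lemma folding_suffix_of_suffix:
  assumes "folding n T" "suffix w T" "2 ^ m - 1 \<le> length w"
  shows "\<exists>S. folding m S \<and> suffix S w"
proof -
  have "prefix (bar w) (bar T)"
    using assms(2) by (metis bar_bar suffix_bar_iff)
  then obtain S where "folding m S" "prefix S (bar w)"
    using folding_prefix_of_prefix[of n "bar T"] assms folding_bar by (metis length_bar)
  then show ?thesis
    using folding_bar by (metis bar_bar suffix_bar_iff)
qed

text \<open>A long window of \<open>bar S @ e # S\<close> lies in one half, where induction applies,
  or straddles the middle. In the second case one of its two pieces contains
  \<open>2 ^ m - 1\<close> terms next to \<open>e\<close>, and those form an
  \<open>m\<close>-folding sequence. This turns the definition of a complete folding sequence, whose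
  blocks merely occur inside folding sequences, into the existence of full folding blocks in
  it.\<close>

lemma folding_window:
  assumes "folding n T" "sublist w T" "2 ^ Suc m \<le> length w"
  shows "\<exists>S. folding m S \<and> sublist S w"
  using assms
proof (induction arbitrary: w rule: folding.induct)
  case folding_0
  then show ?case
    by simp
next
  case (folding_Suc n S e)
  have straddle: "\<exists>S. folding m S \<and> sublist S w" if w: "w = w1 @ w2" "suffix w1 (bar S)" "prefix w2 (e # S)" for w1 w2
  proof (cases "2 ^ m \<le> length w2")
    case True
    then have "w2 \<noteq> []"
      by auto
    then obtain w3 where "w2 = e # w3" "prefix w3 S"
      using w(3) by (auto simp: prefix_Cons)
    then obtain R where R: "folding m R" "prefix R w3"
      using folding_prefix_of_prefix[OF folding_Suc.hyps(1), of w3 m] True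
      by (metis One_nat_def diff_Suc_1 diff_le_mono length_Cons)
    have "sublist w3 w"
      using sublist_append_leftI[of w3 "w1 @ [e]"] by (simp add: w(1) \<open>w2 = e # w3\<close>)
    then have "sublist R w"
      using sublist_order.order.trans[OF prefix_imp_sublist[OF R(2)]] by simp
    then show ?thesis
      using R(1) by blast
  next
    case False
    then have "2 ^ m - 1 \<le> length w1"
      using folding_Suc.prems(2) w(1) by simp
    then obtain R where R: "folding m R" "suffix R w1"
      using folding_suffix_of_suffix[OF folding_bar[OF folding_Suc.hyps(1)] w(2)] by auto
    have "sublist R w"
      unfolding w(1) using sublist_order.order.trans[OF suffix_imp_sublist[OF R(2)]] by simp
    then show ?thesis
      using R(1) by blast
  qed
  consider "sublist w (bar S)" | "sublist w S"
    | w1 w2 where "w = w1 @ w2" "suffix w1 (bar S)" "prefix w2 (e # S)"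
    using folding_Suc.prems(1)
    unfolding sublist_append sublist_Cons_right by (metis append_Nil suffix_bot.bot_least)
  then show ?case
  proof cases
    case 1
    then have "sublist (bar w) S"
      by (metis bar_bar sublist_bar_iff)
    then obtain R where "folding m R" "sublist R (bar w)"
      using folding_Suc.IH folding_Suc.prems(2) by (metis length_bar)
    then show ?thesis
      using folding_bar by (metis bar_bar sublist_bar_iff)
  next
    case 2
    then show ?thesis
      using folding_Suc by blast
  next
    case 3
    then show ?thesis
      using straddle by blast
  qed
qed

section \<open>Folding sequences as coarse folding sequences with alternating fine blocks
  inserted\<close>

fun interleave :: "int list \<Rightarrow> int list \<Rightarrow> int list" where
  "interleave S [] = S"
| "interleave S (t # R) = S @ t # interleave (bar S) R"

lemma interleave_append:
  "interleave S (Q @ e # R) = interleave S Q @ e # interleave (if even (length Q) then bar S else S) R"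
  by (induction Q arbitrary: S) auto

text \<open>There are \<open>length R + 1\<close> alternating blocks, so the parity of
  \<open>length R\<close> decides whether the last one, which \<open>bar\<close> turns into the
  first, is \<open>S\<close> or \<open>bar S\<close>.\<close>

lemma bar_interleave:
  "bar (interleave S R) = interleave (if even (length R) then bar S else S) (bar R)"
  by (induction R arbitrary: S) (auto simp: interleave_append)

text \<open>The last block of \<open>bar T'\<close> is \<open>bar S\<close>, because
  \<open>T'\<close> begins with \<open>S\<close>, and the block after \<open>e\<close> is
  \<open>S\<close>; so the alternation carries across the middle. This is the Toeplitz structure of
  paperfolding sequences.\<close>

lemma folding_interleave:
  assumes "folding (m + r) T"
  shows "\<exists>S R. folding m S \<and> folding r R \<and> T = interleave S R"
  using assms
proof (induction r arbitrary: T)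
  case 0
  then show ?case
    by (metis add_0_right folding_0 interleave.simps(1))
next
  case (Suc r)
  then obtain T' e where T': "folding (m + r) T'" "e \<in> {1, -1}" "T = bar T' @ e # T'"
    by (auto simp: folding_Suc_iff)
  with Suc.IH obtain S R where S: "folding m S" "folding r R" "T' = interleave S R"
    by blast
  let ?X = "if even (length R) then bar S else S"
  have "T = interleave ?X (bar R @ e # R)"
    unfolding T' S by (simp add: bar_interleave interleave_append)
  moreover have "folding m ?X" "folding (Suc r) (bar R @ e # R)"
    using S T' by (auto intro: folding_bar folding_Suc)
  ultimately show ?case
    by blast
qed

text \<open>Cutting off leading terms of \<open>R\<close> also cuts off blocks, and their parity
  decides whether the rest starts with \<open>S\<close> or with \<open>bar S\<close>.\<close>

lemma sublist_interleave:
  assumes "sublist Q R"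
  shows "\<exists>X \<in> {S, bar S}. sublist (interleave X Q) (interleave S R)"
proof -
  have pre: "prefix (interleave S Q) (interleave S (Q @ Q'))" for S Q'
    by (induction Q arbitrary: S) (cases Q', auto)
  obtain P Q' where R: "R = P @ Q @ Q'"
    using assms by (auto simp: sublist_def)
  show ?thesis
    unfolding R
  proof (induction P arbitrary: S)
    case Nil
    then show ?case
      using pre prefix_imp_sublist by auto
  next
    case (Cons t P)
    then obtain X where "X \<in> {bar S, S}" "sublist (interleave X Q) (interleave (bar S) (P @ Q @ Q'))"
      by (metis bar_bar)
    then show ?case
      by (auto simp: sublist_append sublist_Cons_right)
  qed
qed

text \<open>Three folds do not suffice: \<open>[-a,-a,a,c,-a,a,a]\<close> has no three equal
  consecutive terms. With four folds the run lies in the first half if \<open>b = -a\<close>, and it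
  contains the middle term \<open>d\<close> if \<open>b = a\<close>.\<close>

lemma folding_4_run:
  assumes "folding 4 R"
  shows "\<exists>u t v. t \<in> {1, -1} \<and> sublist [u, t, t, t, v] R"
proof -
  have "folding (Suc (Suc (Suc (Suc 0)))) R"
    using assms by (simp add: eval_nat_numeral)
  then obtain a b c d where e: "a \<in> {1, -1}" "b \<in> {1, -1}" "c \<in> {1, -1}" "d \<in> {1, -1}"
    and "R = (\<lambda>S. bar S @ d # S) ((\<lambda>S. bar S @ c # S) ((\<lambda>S. bar S @ b # S) [a]))"
    unfolding folding_Suc_iff folding_0_iff by (elim exE conjE) (simp del: bar_append)
  then have R: "R = [-a,-b,a,-c,-a,b,a,d,-a,-b,a,c,-a,b,a]"
    by simp
  consider "b = -a" "c = -a" | "b = -a" "c = a" | "b = a" "d = a" | "b = a" "d = -a"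
    using e by fastforce
  then show ?thesis
  proof cases
    case 1
    then have "R = [] @ [-a,a,a,a,-a] @ [-a,a,d,-a,a,a,-a,-a,-a,a]"
      by (simp add: R)
    then show ?thesis
      using e(1) by (metis sublist_appendI)
  next
    case 2
    then have "R = [-a,a] @ [a,-a,-a,-a,a] @ [d,-a,a,a,a,-a,-a,a]"
      by (simp add: R)
    moreover have "-a \<in> {1,-1}"
      using e by auto
    ultimately show ?thesis
      by (metis sublist_appendI)
  next
    case 3
    then have "R = [-a,-a,a,-c] @ [-a,a,a,a,-a] @ [-a,a,c,-a,a,a]"
      by (simp add: R)
    then show ?thesis
      using e(1) by (metis sublist_appendI)
  next
    case 4
    then have "R = [-a,-a,a,-c,-a,a] @ [a,-a,-a,-a,a] @ [c,-a,a,a]"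
      by (simp add: R)
    moreover have "-a \<in> {1,-1}"
      using e by auto
    ultimately show ?thesis
      by (metis sublist_appendI)
  qed
qed

lemma complete_folding_pattern:
  assumes "complete_folding a"
  shows "\<exists>S u t v k. folding n S \<and> t \<in> {1, -1} \<and>
    (\<forall>i < 6 * 2 ^ n - 1. a (k + int i) =
       (bar S @ u # S @ t # bar S @ t # S @ t # bar S @ v # S) ! i)"
proof -
  \<comment> \<open>By \<open>folding_window\<close> a window of this length contains an
    \<open>(n + 4)\<close>-folding block: \<open>n\<close> folds for the strokes \<open>S\<close>
    and 4 for the run of equal turns.\<close>
  define l :: nat where "l = 2 ^ Suc (n + 4)"
  obtain N T where T: "folding N T" "sublist (map a [0 + 1..0 + int l]) T"
    using assms unfolding complete_folding_def by blast
  have "length (map a [0 + 1..0 + int l]) = l"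
    by simp
  then obtain T' where "folding (n + 4) T'" "sublist T' (map a [0 + 1..0 + int l])"
    using folding_window[OF T, of "n + 4"] l_def by auto
  moreover then obtain S R where S: "folding n S" "folding 4 R" "T' = interleave S R"
    using folding_interleave by blast
  moreover obtain u t v where t: "t \<in> {1, -1}" "sublist [u, t, t, t, v] R"
    using folding_4_run S by blast
  moreover then obtain X where X: "X \<in> {S, bar S}" "sublist (interleave X [u, t, t, t, v]) (interleave S R)"
    using sublist_interleave by blast
  ultimately have "sublist (interleave X [u, t, t, t, v]) (map a [0 + 1..0 + int l])"
    by (metis sublist_order.order.trans)
  then obtain P Q where PQ: "map a [1..int l] = P @ interleave X [u, t, t, t, v] @ Q"
    by (auto simp: sublist_def)
  \<comment> \<open>The pattern in the statement opens with \<open>bar S\<close>, so the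
    \<open>S\<close> to be exhibited is the \<open>bar\<close> of the first block.\<close>
  define Y where "Y = bar X"
  define W where "W = bar Y @ u # Y @ t # bar Y @ t # Y @ t # bar Y @ v # Y"
  have W: "W = interleave X [u, t, t, t, v]"
    by (simp add: W_def Y_def)
  have Y: "folding n Y"
    using X S folding_bar by (auto simp: Y_def)
  \<comment> \<open>Six blocks of \<open>2 ^ n - 1\<close> terms and the five terms
    \<open>u, t, t, t, v\<close>.\<close>
  have len: "length W = 6 * 2 ^ n - 1"
  proof -
    have "length Y + 1 = 2 ^ n"
      using length_folding[OF Y] by simp
    then show ?thesis
      unfolding W_def by simp
  qed
     
  have "a (int (length P) + 1 + int i) = W ! i" if "i < 6 * 2 ^ n - 1" for i
  proof -
    have lt: "length P + i < l"
      using arg_cong[OF PQ, of length] that len W by simp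
    have "W ! i = map a [1..int l] ! (length P + i)"
      unfolding PQ nth_append_length_plus nth_append_left[OF that[folded len, unfolded W]] W ..
    also have "\<dots> = a (1 + int (length P + i))"
      using lt by (simp add: nth_upto)
    finally show ?thesis
      by (simp add: algebra_simps)
  qed
  then show ?thesis
    using Y t W_def by blast
qed

section \<open>Flows\<close>

definition osegs :: "oseg set" where
  "osegs = gauss_ints \<times> {1, -1, \<i>, -\<i>}"

definition joins :: "oseg \<Rightarrow> oseg \<Rightarrow> bool" where
  "joins s t \<longleftrightarrow> fst t = fst s + snd s \<and> snd t \<in> {\<i> * snd s, - \<i> * snd s}"

text \<open>The value is -1 also when \<open>t\<close> does not continue \<open>s\<close>, so it
  always lies in \<open>{1, -1}\<close>; it is meaningful only under \<open>joins\<close>.\<close>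

definition turn :: "oseg \<Rightarrow> oseg \<Rightarrow> int" where
  "turn s t = (if snd t = \<i> * snd s then 1 else -1)"

definition follows :: "(oseg \<Rightarrow> oseg option) \<Rightarrow> (nat \<Rightarrow> oseg) \<Rightarrow> nat \<Rightarrow> bool" where
  "follows h p n \<longleftrightarrow> (\<forall>i<n. h (p i) = Some (p (Suc i)))"

text \<open>The orientation convention for a set of segments, with its parity bit \<open>b\<close>
  as a parameter: translations may flip it, and in a limit it has to be recovered.\<close>

definition oriented :: "oseg set \<Rightarrow> bool \<Rightarrow> bool" where
  "oriented G b \<longleftrightarrow> (\<forall>x y::int. let z = of_int x + \<i> * of_int y in
     {s \<in> G. fst s = z \<or> fst s + snd s = z} =
       (if even (x + y) = b then horizontal_out z else vertical_out z))"

lemma i_powi [simp]: "\<i> powi 1 = \<i>" "\<i> powi (- 1) = - \<i>"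
  by (simp_all add: power_int_minus)

lemma joins_turn: "joins s t \<Longrightarrow> snd t = \<i> powi turn s t * snd s"
  by (auto simp: joins_def turn_def)

lemma turn_eqI: "snd t = \<i> powi a * snd s \<Longrightarrow> snd s \<noteq> 0 \<Longrightarrow> a \<in> {1, -1} \<Longrightarrow> turn s t = a"
  by (auto simp: turn_def)

lemma gauss_ints_iff: "z \<in> gauss_ints \<longleftrightarrow> (\<exists>x y::int. z = of_int x + \<i> * of_int y)"
proof
  assume "z \<in> gauss_ints"
  then obtain x y where "Re z = of_int x" "Im z = of_int y"
    by (auto simp: gauss_ints_def elim!: Ints_cases)
  then have "z = of_int x + \<i> * of_int y"
    by (simp add: complex_eq_iff)
  then show "\<exists>x y::int. z = of_int x + \<i> * of_int y"
    by blast
qed (auto simp: gauss_ints_def)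

lemma gauss_ints_add: "z \<in> gauss_ints \<Longrightarrow> w \<in> gauss_ints \<Longrightarrow> z + w \<in> gauss_ints"
  by (auto simp: gauss_ints_def)

lemma gauss_ints_minus: "z \<in> gauss_ints \<Longrightarrow> - z \<in> gauss_ints"
  by (auto simp: gauss_ints_def)

lemma units_gauss_ints: "{1, -1, \<i>, -\<i>} \<subseteq> gauss_ints"
  by (auto simp: gauss_ints_def)

lemma support_eq_iff: "support (x, e) = closed_segment z (z + f) \<longleftrightarrow> (x, e) \<in> {(z, f), (z + f, - f)}"
  by (auto simp: support_def closed_segment_eq doubleton_eq_iff eq_neg_iff_add_eq_0 algebra_simps)

lemma oriented_edge:
  assumes "oriented G b" "z \<in> gauss_ints" "f \<in> {1, \<i>}"
  shows "(z, f) \<in> G \<longleftrightarrow> (z + f, - f) \<notin> G"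
proof -
  obtain x y :: int where z: "z = of_int x + \<i> * of_int y"
    using assms(2) gauss_ints_iff by blast
  have "{s \<in> G. fst s = z \<or> fst s + snd s = z} =
    (if even (x + y) = b then horizontal_out z else vertical_out z)"
    using assms(1) unfolding oriented_def z Let_def by blast
  moreover have "(z, f) \<in> G \<longleftrightarrow> (z, f) \<in> {s \<in> G. fst s = z \<or> fst s + snd s = z}"
    "(z + f, - f) \<in> G \<longleftrightarrow> (z + f, - f) \<in> {s \<in> G. fst s = z \<or> fst s + snd s = z}"
    by auto
  moreover have "(z, f) \<in> horizontal_out z \<longleftrightarrow> (z + f, - f) \<notin> horizontal_out z"
    "(z, f) \<in> vertical_out z \<longleftrightarrow> (z + f, - f) \<notin> vertical_out z"
    using assms(3) by (auto simp: horizontal_out_def vertical_out_def complex_eq_iff)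
  ultimately show ?thesis
    by presburger
qed

text \<open>A flow is the successor map of the oriented segments of a covering. The curves of the
  covering are its orbits, so a covering and its flow determine each other; since every axiom
  below involves only finitely many segments at a time, flows are stable under pointwise limits.\<close>

locale flow =
  fixes h :: "oseg \<Rightarrow> oseg option"
  assumes dom_osegs: "dom h \<subseteq> osegs"
    and step: "h s = Some t \<Longrightarrow> joins s t \<and> t \<in> dom h"
    and inj: "h s = Some t \<Longrightarrow> h s' = Some t \<Longrightarrow> s = s'"
    and surj: "t \<in> dom h \<Longrightarrow> \<exists>s. h s = Some t"
    and acyclic: "follows h p n \<Longrightarrow> 0 < n \<Longrightarrow> p n \<noteq> p 0"
    and foldings: "follows h p n \<Longrightarrow>
      \<exists>N S. folding N S \<and> sublist (map (\<lambda>i. turn (p i) (p (Suc i))) [0..<n]) S"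
    and orientation: "\<exists>b. oriented (dom h) b"
begin

definition line :: "(int \<Rightarrow> oseg) \<Rightarrow> bool" where
  "line c \<longleftrightarrow> (\<forall>k. h (c k) = Some (c (k + 1)))"

lemma ex_line:
  assumes "s \<in> dom h"
  shows "\<exists>c. line c \<and> c 0 = s"
proof -
  define f where "f = (\<lambda>s. the (h s))"
  define g where "g = (\<lambda>t. SOME s. h s = Some t)"
  have f: "f s \<in> dom h" "h s = Some (f s)" if "s \<in> dom h" for s
    using that step unfolding f_def by (metis domIff option.exhaust_sel)+
  have g: "g t \<in> dom h" "h (g t) = Some t" if "t \<in> dom h" for t
    using surj[OF that] unfolding g_def by (metis (mono_tags, lifting) domI someI_ex)+
  have fn: "(f ^^ n) s \<in> dom h" "(g ^^ n) s \<in> dom h" for n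
    using assms f g by (induction n) auto
  define c where "c = (\<lambda>k. if 0 \<le> k then (f ^^ nat k) s else (g ^^ nat (- k)) s)"
  have "h (c k) = Some (c (k + 1))" for k
  proof (cases "0 \<le> k")
    case True
    then show ?thesis
      using f(2)[OF fn(1)] by (simp add: c_def nat_add_distrib)
  next
    case False
    then obtain n where k: "k = - int (Suc n)"
      by (metis int_cases nonneg_eq_int of_nat_0_le_iff)
    have "c k = g ((g ^^ n) s)"
    proof -
      have "nat (- k) = Suc n"
        using k by simp
      then show ?thesis
        using k by (simp add: c_def)
    qed
    moreover have "c (k + 1) = (g ^^ n) s"
      unfolding c_def k by simp
    ultimately show ?thesis
      using g(2)[OF fn(2)] by simp
  qed
  then have "line c" "c 0 = s"
    by (auto simp: line_def c_def)
  then show ?thesis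
    by blast
qed

lemma line_unique:
  assumes "line c" "line d" "c i = d j"
  shows "c (i + k) = d (j + k)"
proof (induction k rule: int_induct[where k = 0])
  case (step1 k)
  then show ?case
    using assms(1,2) unfolding line_def by (metis add.assoc option.inject)
next
  case (step2 k)
  then have "h (c (i + (k - 1))) = Some (c (i + k))" "h (d (j + (k - 1))) = Some (c (i + k))"
    using assms(1,2) unfolding line_def by (metis add_diff_eq diff_add_cancel)+
  then show ?case
    using inj by blast
qed (use assms in simp)

lemma line_follows: "line c \<Longrightarrow> follows h (\<lambda>i. c (k + int i)) n"
  by (simp add: line_def follows_def add.assoc[symmetric] add.commute[of 1])

lemma line_inj:
  assumes "line c" "c i = c j"
  shows "i = j"
proof -
  have "False" if "i < j" "c i = c j" for i j
    using acyclic[OF line_follows[OF assms(1), of i "nat (j - i)"]] that by simp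
  then show ?thesis
    using assms(2) by (metis linorder_neqE)
qed

text \<open>A covering contains only one parametrization of each of its curves.\<close>

definition canonical :: "(int \<Rightarrow> oseg) \<Rightarrow> int \<Rightarrow> oseg" where
  "canonical c = (SOME d. line d \<and> range d = range c)"

lemma canonical: "line c \<Longrightarrow> line (canonical c)" "line c \<Longrightarrow> range (canonical c) = range c"
  unfolding canonical_def by (metis (mono_tags, lifting) someI)+

definition curves :: "curve set" where
  "curves = {Some \<circ> canonical c |c. line c}"

lemma curvesE:
  assumes "C \<in> curves"
  obtains c where "line c" "C = Some \<circ> c"
  using assms canonical by (auto simp: curves_def)

lemma ex_curve:
  assumes "s \<in> dom h"
  shows "\<exists>C\<in>curves. \<exists>k. C k = Some s"
proof -
  obtain c where c: "line c" "c 0 = s"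
    using ex_line[OF assms] by blast
  then have "s \<in> range (canonical c)"
    using canonical(2) by blast
  then obtain k where "s = canonical c k"
    by blast
  moreover have "Some \<circ> canonical c \<in> curves"
    using c(1) by (auto simp: curves_def)
  ultimately show ?thesis
    by (metis comp_apply)
qed

text \<open>\<open>canonical c\<close> depends on \<open>c\<close> only through
  \<open>range c\<close>. Orbits that share a segment have the same range, hence the same
  representative, and injectivity of that representative gives equal indices.\<close>

lemma curve_unique:
  assumes "C \<in> curves" "C' \<in> curves" "C k = Some s" "C' k' = Some s"
  shows "C = C'" "k = k'"
proof -
  obtain c where c: "line c" "C = Some \<circ> canonical c"
    using assms by (auto simp: curves_def)
  obtain c' where c': "line c'" "C' = Some \<circ> canonical c'"
    using assms by (auto simp: curves_def)
  have eq: "canonical c k = canonical c' k'"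
    using assms c c' by simp
  have "canonical c i \<in> range (canonical c')" "canonical c' i \<in> range (canonical c)" for i
    using line_unique[OF canonical(1)[OF c(1)] canonical(1)[OF c'(1)] eq, of "i - k"]
      line_unique[OF canonical(1)[OF c'(1)] canonical(1)[OF c(1)] eq[symmetric], of "i - k'"]
    by (simp_all)
  then have "range (canonical c) = range (canonical c')"
    by blast
  then have "range c = range c'"
    using canonical(2) c c' by simp
  then have "canonical c = canonical c'"
    unfolding canonical_def by simp
  then show "C = C'" "k = k'"
    using c c' eq line_inj[OF canonical(1)[OF c(1)]] by auto
qed

lemma segments_curves: "segments curves = dom h"
proof
  show "segments curves \<subseteq> dom h"
  proof
    fix s assume "s \<in> segments curves"
    then obtain C k where "C \<in> curves" "C k = Some s"
      by (auto simp: segments_def ran_def)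
    then show "s \<in> dom h"
      by (metis comp_apply curvesE domI line_def option.inject)
  qed
  show "dom h \<subseteq> segments curves"
    using ex_curve unfolding segments_def ran_def by blast
qed

lemma complete_folding_curves:
  assumes "C \<in> curves"
  shows "complete_folding_curve C"
proof -
  obtain c where c: "line c" "C = Some \<circ> c"
    using assms by (rule curvesE)
  define a where "a = (\<lambda>k. turn (c k) (c (k + 1)))"
  have j: "joins (c k) (c (k + 1))" "c k \<in> osegs" for k
    using c(1) step dom_osegs unfolding line_def by blast+
  have "curve_of UNIV a C"
    unfolding curve_of_def
  proof (intro conjI allI impI)
    fix k x e assume "C k = Some (x, e)"
    then show "x \<in> gauss_ints" "e \<in> {1, - 1, \<i>, - \<i>}"
      using j(2)[of k] by (auto simp: c(2) osegs_def)
  next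
    fix k x e x' e' assume "C k = Some (x, e) \<and> C (k + 1) = Some (x', e')"
    then show "x + e = x'" "e' = \<i> powi a k * e"
      using j(1)[of k] joins_turn[OF j(1), of k] by (auto simp: c(2) a_def joins_def)
  next
    show "a k \<in> {1, - 1}" for k
      by (simp add: a_def turn_def)
  qed (use c in auto)
  moreover have "complete_folding a"
    unfolding complete_folding_def
  proof (intro conjI allI)
    fix k :: int and l :: nat
    have "map a [k + 1..k + int l] =
      map (\<lambda>i. turn (c (k + 1 + int i)) (c (k + 1 + int (Suc i)))) [0..<l]"
      by (rule nth_equalityI) (auto simp: a_def algebra_simps)
    then show "\<exists>n S. folding n S \<and> sublist (map a [k + 1..k + int l]) S"
      using foldings[OF line_follows[OF c(1), of "k + 1" l]] by simp
  qed (simp add: a_def turn_def)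
  ultimately show ?thesis
    unfolding complete_folding_curve_def by blast
qed

text \<open>By the orientation convention exactly one of the two orientations of an edge is in
  \<open>dom h\<close>, and \<open>curve_unique\<close> puts this segment at exactly one index of
  one chosen curve.\<close>

lemma covering_curves: "covering curves"
  unfolding covering_def
proof (intro conjI ballI)
  show "complete_curve C" if "C \<in> curves" for C
    using complete_folding_curves[OF that]
    unfolding complete_folding_curve_def complete_curve_def by blast
  show "orientation_convention curves"
    using orientation unfolding orientation_convention_def segments_curves oriented_def .
  fix z f :: complex assume z: "z \<in> gauss_ints" "f \<in> {1, \<i>}"
  then have "(z, f) \<in> dom h \<longleftrightarrow> (z + f, - f) \<notin> dom h"
    using orientation oriented_edge by blast
  then have "\<exists>!s. s \<in> dom h \<and> s \<in> {(z, f), (z + f, - f)}"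
    by blast
  then obtain s where s: "s \<in> dom h" "support s = closed_segment z (z + f)"
    and uniq: "\<And>s'. s' \<in> dom h \<Longrightarrow> support s' = closed_segment z (z + f) \<Longrightarrow> s' = s"
    using support_eq_iff by (metis surj_pair)
  obtain C k where C: "C \<in> curves" "C k = Some s"
    using ex_curve[OF s(1)] by blast
  have *: "C' = C \<and> k' = k" if "C' \<in> curves" "C' k' = Some s'" "support s' = closed_segment z (z + f)" for C' k' s'
  proof -
    have "s' \<in> dom h"
      using that segments_curves unfolding segments_def ran_def by blast
    then have "s' = s"
      using uniq that by blast
    then show ?thesis
      using curve_unique that C by blast
  qed
  show "\<exists>!(C, k). C \<in> curves \<and> (\<exists>s. C k = Some s \<and> support s = closed_segment z (z + f))"
  proof (rule ex1I[of _ "(C, k)"])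
    show "case (C, k) of (C, k) \<Rightarrow> C \<in> curves \<and>
        (\<exists>s. C k = Some s \<and> support s = closed_segment z (z + f))"
      using C s(2) by (cases s) simp
    show "q = (C, k)" if "case q of (C, k) \<Rightarrow> C \<in> curves \<and>
        (\<exists>s. C k = Some s \<and> support s = closed_segment z (z + f))" for q
      using that * by (cases q) (simp, metis)
  qed
qed

end

section \<open>The successor map of a covering is a flow\<close>

definition nxt :: "curve set \<Rightarrow> oseg \<Rightarrow> oseg option" where
  "nxt \<C> s = (if s \<in> segments \<C> then Some (SOME t. \<exists>C\<in>\<C>. \<exists>k. C k = Some s \<and> C (k + 1) = Some t)
    else None)"

lemma dom_nxt: "dom (nxt \<C>) = segments \<C>"
  by (auto simp: nxt_def split: if_splits)

context
  fixes \<C> :: "curve set"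
  assumes covering: "covering \<C>"
begin

lemma covering_curve_total:
  assumes "C \<in> \<C>"
  obtains c where "C = Some \<circ> c"
proof -
  have "dom C = UNIV"
    using covering assms by (auto simp: covering_def complete_curve_def curve_of_def)
  then have "C k = Some (the (C k))" for k
    by (metis UNIV_I domIff option.collapse)
  then have "C = Some \<circ> (\<lambda>k. the (C k))"
    by (intro ext) simp
  then show ?thesis
    by (rule that)
qed

lemma covering_joins:
  assumes "C \<in> \<C>" "C k = Some s" "C (k + 1) = Some t"
  shows "joins s t" "s \<in> osegs"
proof -
  obtain a where a: "curve_of UNIV a C"
    using covering assms(1) by (auto simp: covering_def complete_curve_def)
  then have ak: "a k \<in> {1, -1}"
    by (auto simp: curve_of_def)
  have "fst s + snd s = fst t \<and> snd t = \<i> powi a k * snd s"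
    using a assms(2,3) unfolding curve_of_def by (metis prod.collapse)
  then show "joins s t"
    using ak by (auto simp: joins_def)
  have "fst s \<in> gauss_ints \<and> snd s \<in> {1, -1, \<i>, -\<i>}"
    using a assms(2) unfolding curve_of_def by (metis prod.collapse)
  then show "s \<in> osegs"
    unfolding osegs_def by (metis mem_Times_iff)
qed

lemma segments_osegs: "segments \<C> \<subseteq> osegs"
proof
  fix s assume "s \<in> segments \<C>"
  then obtain C k where C: "C \<in> \<C>" "C k = Some s"
    by (auto simp: segments_def ran_def)
  obtain c where "C = Some \<circ> c"
    using covering_curve_total[OF C(1)] .
  then show "s \<in> osegs"
    using covering_joins(2)[OF C] by simp
qed

text \<open>The covering condition speaks of edges in the directions 1 and \<i>; a segment in
  direction -1 or -\<i> is brought to that form by taking its endpoint as base point. As only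
  supports are compared, an edge cannot be used twice in opposite directions either.\<close>

lemma covering_unique:
  assumes "C \<in> \<C>" "C' \<in> \<C>" "C k = Some s" "C' k' = Some s'" "support s = support s'"
  shows "C = C'" "k = k'"
proof -
  obtain x e where s: "s = (x, e)"
    by fastforce
  have "s \<in> osegs"
    using segments_osegs assms by (auto simp: segments_def ran_def)
  then have x: "x \<in> gauss_ints" "e \<in> {1, -1, \<i>, -\<i>}"
    by (auto simp: s osegs_def)
  have "\<exists>z\<in>gauss_ints. \<exists>f\<in>{1, \<i>}. support s = closed_segment z (z + f)"
  proof (cases "e \<in> {1, \<i>}")
    case True
    then show ?thesis
      using x(1) by (auto simp: s support_def)
  next
    case False
    then have "- e \<in> {1, \<i>}" "x + e \<in> gauss_ints"
      using x gauss_ints_add units_gauss_ints by auto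
    moreover have "support s = closed_segment (x + e) (x + e + - e)"
      by (simp add: s support_def closed_segment_commute)
    ultimately show ?thesis
      by blast
  qed
  then obtain z f where zf: "z \<in> gauss_ints" "f \<in> {1, \<i>}" "support s = closed_segment z (z + f)"
    by blast
  let ?P = "\<lambda>(C, k). C \<in> \<C> \<and> (\<exists>s. C k = Some s \<and> support s = closed_segment z (z + f))"
  have ex1: "Ex1 ?P"
    using covering[unfolded covering_def, THEN conjunct2, THEN conjunct1, THEN bspec, OF zf(1), THEN bspec, OF zf(2)] .
  have P: "?P (C, k)" "?P (C', k')"
    unfolding case_prod_conv using assms zf(3) by metis+
  have "(C, k) = (C', k')"
    using the1_equality[OF ex1 P(1)] the1_equality[OF ex1 P(2)] by (rule trans[OF sym])
  then show "C = C'" "k = k'"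
    by auto
qed

text \<open>In a covering a segment has exactly one position, so the choice in \<open>nxt\<close>
  has a single candidate.\<close>

lemma nxt_curve:
  assumes "C \<in> \<C>" "C k = Some s"
  shows "nxt \<C> s = C (k + 1)"
proof -
  have "s \<in> segments \<C>"
    using assms by (auto simp: segments_def ran_def)
  moreover obtain c where c: "C = Some \<circ> c"
    using covering_curve_total[OF assms(1)] .
  moreover have "(SOME t. \<exists>C\<in>\<C>. \<exists>k. C k = Some s \<and> C (k + 1) = Some t) = c (k + 1)"
  proof (rule some_equality)
    show "\<exists>C\<in>\<C>. \<exists>k'. C k' = Some s \<and> C (k' + 1) = Some (c (k + 1))"
      using assms c by (metis comp_apply)
    show "t = c (k + 1)" if "\<exists>C\<in>\<C>. \<exists>k. C k = Some s \<and> C (k + 1) = Some t" for t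
      using that covering_unique assms c by (metis comp_apply option.inject)
  qed
  ultimately show ?thesis
    by (simp add: nxt_def)
qed

lemma nxtE:
  assumes "nxt \<C> s = Some t"
  obtains C k where "C \<in> \<C>" "C k = Some s" "C (k + 1) = Some t"
proof -
  have "s \<in> segments \<C>"
    using assms dom_nxt by blast
  then obtain C k where "C \<in> \<C>" "C k = Some s"
    by (auto simp: segments_def ran_def)
  then show ?thesis
    using assms nxt_curve that by metis
qed

lemma follows_nxt_curve:
  assumes "C \<in> \<C>" "C k = Some (p 0)" "follows (nxt \<C>) p n" "i \<le> n"
  shows "C (k + int i) = Some (p i)"
  using assms(4)
proof (induction i)
  case (Suc i)
  then have "Some (p (Suc i)) = nxt \<C> (p i)" "C (k + int i) = Some (p i)"
    using assms(3) by (auto simp: follows_def)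
  then show ?case
    using nxt_curve[OF assms(1), of "k + int i"] by (simp add: algebra_simps)
qed (use assms in simp)

text \<open>A path of \<open>nxt\<close> runs along consecutive indices of one curve. Hence a closed
  path would place one segment at two indices, and the turns along any path form a block of a
  complete folding sequence.\<close>

lemma covering_flow:
  assumes "\<forall>C\<in>\<C>. complete_folding_curve C"
  shows "flow (nxt \<C>)"
proof
  show "dom (nxt \<C>) \<subseteq> osegs"
    using segments_osegs by (simp add: dom_nxt)
  show "\<exists>b. oriented (dom (nxt \<C>)) b"
    using covering unfolding covering_def orientation_convention_def dom_nxt oriented_def by blast
next
  fix s t assume "nxt \<C> s = Some t"
  then obtain C k where C: "C \<in> \<C>" "C k = Some s" "C (k + 1) = Some t"
    by (rule nxtE)
  then show "joins s t \<and> t \<in> dom (nxt \<C>)"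
    using covering_joins by (auto simp: dom_nxt segments_def ran_def)
next
  fix s s' t assume "nxt \<C> s = Some t" "nxt \<C> s' = Some t"
  then show "s = s'"
    using covering_unique by (elim nxtE) (metis add_right_cancel option.inject)
next
  fix t assume "t \<in> dom (nxt \<C>)"
  then obtain C k where C: "C \<in> \<C>" "C k = Some t"
    by (auto simp: dom_nxt segments_def ran_def)
  moreover obtain c where c: "C = Some \<circ> c"
    using covering_curve_total[OF C(1)] .
  ultimately have "nxt \<C> (c (k - 1)) = Some t"
    using nxt_curve[OF C(1), of "k - 1"] by simp
  then show "\<exists>s. nxt \<C> s = Some t"
    by blast
next
  fix p n assume p: "follows (nxt \<C>) p n"
  show "p n \<noteq> p 0" if "0 < n"
  proof
    assume eq: "p n = p 0"
    obtain t where "nxt \<C> (p 0) = Some t"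
      using p \<open>0 < n\<close> by (auto simp: follows_def)
    then obtain C k where C: "C \<in> \<C>" "C k = Some (p 0)"
      by (rule nxtE)
    have "C (k + int n) = Some (p n)"
      using follows_nxt_curve[OF C p order_refl] .
    then have "k = k + int n"
      by (rule covering_unique(2)[OF C(1) C(1) C(2)]) (simp add: eq)
    then show False
      using that by simp
  qed
  show "\<exists>N S. folding N S \<and> sublist (map (\<lambda>i. turn (p i) (p (Suc i))) [0..<n]) S"
  proof (cases "n = 0")
    case True
    then show ?thesis
      by (intro exI[of _ 0] exI[of _ "[]"]) simp
  next
    case False
    then obtain t where "nxt \<C> (p 0) = Some t"
      using p by (auto simp: follows_def)
    then obtain C k where C: "C \<in> \<C>" "C k = Some (p 0)"
      by (rule nxtE)
    obtain a where a: "complete_folding a" "curve_of UNIV a C"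
      using assms C(1) unfolding complete_folding_curve_def by blast
    have "turn (p i) (p (Suc i)) = a (k + int i)" if "i < n" for i
    proof (rule turn_eqI)
      have pi: "C (k + int i) = Some (p i)" "C (k + int i + 1) = Some (p (Suc i))"
        using follows_nxt_curve[OF C p, of i] follows_nxt_curve[OF C p, of "Suc i"] that
        by (simp_all add: algebra_simps)
      then show "snd (p (Suc i)) = \<i> powi a (k + int i) * snd (p i)"
        using a(2) unfolding curve_of_def by (metis prod.collapse)
      show "snd (p i) \<noteq> 0"
        using covering_joins(2)[OF C(1) pi] by (auto simp: osegs_def)
      show "a (k + int i) \<in> {1, -1}"
        using a(1) unfolding complete_folding_def by blast
    qed
    \<comment> \<open>Blocks in \<open>complete_folding\<close> start at index \<open>k + 1\<close>,
      hence the base index \<open>k - 1\<close> here.\<close>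
    then have "map (\<lambda>i. turn (p i) (p (Suc i))) [0..<n] = map a [k - 1 + 1..k - 1 + int n]"
      by (intro nth_equalityI) auto
    then show ?thesis
      using a(1) unfolding complete_folding_def by metis
  qed
qed

end

lemma (in flow) nxt_curves: "nxt curves = h"
proof
  fix s
  show "nxt curves s = h s"
  proof (cases "s \<in> dom h")
    case True
    then obtain C k where C: "C \<in> curves" "C k = Some s"
      using ex_curve by blast
    then obtain c where "line c" "C = Some \<circ> c"
      using curvesE by blast
    then show ?thesis
      using nxt_curve[OF covering_curves C] C(2) by (metis comp_apply line_def option.inject)
  next
    case False
    then show ?thesis
      using segments_curves by (metis domIff nxt_def)
  qed
qed

section \<open>Bounded patterns\<close>

text \<open>Finite curves in the sense of \<open>is_curve\<close> have domain \<open>{1..n}\<close>,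
  but a set that equals a bounded one up to shifts may have members indexed by any nonempty finite
  interval. This notion is invariant under shifts.\<close>

definition arc_curve :: "curve \<Rightarrow> bool" where
  "arc_curve B \<longleftrightarrow> (\<exists>i j. i \<le> j \<and> dom B = {i..j})"

text \<open>The relation \<open>less_curves\<close> between \<open>\<B>\<close> and a covering with flow \<open>h\<close>, expressed through the
  values of \<open>h\<close> on the segments of \<open>\<B>\<close> alone.\<close>

definition local_less :: "curve set \<Rightarrow> (oseg \<Rightarrow> oseg option) \<Rightarrow> bool" where
  "local_less \<B> h \<longleftrightarrow>
     (\<forall>B\<in>\<B>. \<forall>k s. B k = Some s \<longrightarrow> s \<in> dom h \<and> (\<forall>t. B (k + 1) = Some t \<longrightarrow> h s = Some t)) \<and>
     (\<forall>p n. (\<forall>i\<le>n. p i \<in> segments \<B>) \<and> follows h p n \<longrightarrow>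
        (\<exists>B\<in>\<B>. \<exists>m. \<forall>i\<le>n. B (m + int i) = Some (p i)))"

lemma segmentsI: "B \<in> \<B> \<Longrightarrow> B k = Some s \<Longrightarrow> s \<in> segments \<B>"
  by (auto simp: segments_def ran_def)

lemma segmentsE:
  assumes "s \<in> segments \<B>"
  obtains B k where "B \<in> \<B>" "B k = Some s"
  using assms by (auto simp: segments_def ran_def)

text \<open>Finitely many values of a flow decide whether a bounded pattern occurs in it; this is
  what transfers patterns between a limit and its approximants.\<close>

lemma local_less_cong:
  assumes "\<And>s. s \<in> segments \<B> \<Longrightarrow> h s = h' s"
  shows "local_less \<B> h \<longleftrightarrow> local_less \<B> h'"
proof -
  have "local_less \<B> h'" if eq: "\<And>s. s \<in> segments \<B> \<Longrightarrow> h s = h' s" and less: "local_less \<B> h" for h h'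
    unfolding local_less_def
  proof (intro conjI ballI allI impI)
    fix B k s assume B: "B \<in> \<B>" "B k = Some s"
    then have "h s = h' s"
      using eq segmentsI by blast
    moreover have "s \<in> dom h" "B (k + 1) = Some t \<Longrightarrow> h s = Some t" for t
      using less B unfolding local_less_def by blast+
    ultimately show "s \<in> dom h'" "B (k + 1) = Some t \<Longrightarrow> h' s = Some t" for t
      by (metis domIff)+
  next
    fix p n assume p: "(\<forall>i\<le>n. p i \<in> segments \<B>) \<and> follows h' p n"
    then have "follows h p n"
      using eq by (simp add: follows_def)
    then show "\<exists>B\<in>\<B>. \<exists>m. \<forall>i\<le>n. B (m + int i) = Some (p i)"
      using less p unfolding local_less_def by blast
  qed
  then show ?thesis
    using assms by metis
qed

lemma same_curves_sym: "same_curves \<B> \<C> \<Longrightarrow> same_curves \<C> \<B>"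
  by (simp add: same_curves_def)

lemma same_curves_shift:
  assumes "same_curves \<B> \<C>" "B \<in> \<B>"
  shows "\<exists>C\<in>\<C>. \<exists>m. \<forall>k. B k = C (k + m)"
proof -
  have "shift_class B \<in> shift_class ` \<C>"
    using assms unfolding same_curves_def by blast
  then obtain C where C: "C \<in> \<C>" "shift_class B = shift_class C"
    by blast
  moreover have "B \<in> shift_class B"
    unfolding shift_class_def by (auto intro!: exI[of _ 0])
  ultimately show ?thesis
    unfolding shift_class_def by blast
qed

lemma same_curves_segments:
  assumes "same_curves \<B> \<C>"
  shows "segments \<B> = segments \<C>"
proof -
  have "segments \<B> \<subseteq> segments \<C>" if "same_curves \<B> \<C>" for \<B> \<C>
    using same_curves_shift[OF that] segmentsI segmentsE by (metis subsetI)
  then show ?thesis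
    using assms same_curves_sym by blast
qed

lemma arc_curve_shift:
  assumes "arc_curve C" "\<And>k. B k = C (k + m)"
  shows "arc_curve B"
proof -
  obtain i j where "i \<le> j" "dom C = {i..j}"
    using assms(1) by (auto simp: arc_curve_def)
  moreover have "k \<in> dom B \<longleftrightarrow> k + m \<in> dom C" for k
    by (simp add: assms(2) domIff)
  ultimately have "k \<in> dom B \<longleftrightarrow> i \<le> k + m \<and> k + m \<le> j" for k
    by simp
  then have "k \<in> dom B \<longleftrightarrow> k \<in> {i - m..j - m}" for k
    by (simp only: atLeastAtMost_iff) arith
  then have "dom B = {i - m..j - m}"
    by blast
  then show ?thesis
    using \<open>i \<le> j\<close> unfolding arc_curve_def by (intro exI[of _ "i - m"] exI[of _ "j - m"]) simp
qed

lemma local_less_same_curves: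
  assumes "same_curves \<B> \<B>'" "local_less \<B>' h"
  shows "local_less \<B> h"
  unfolding local_less_def
proof (intro conjI ballI allI impI)
  fix B k s assume B: "B \<in> \<B>" "B k = Some s"
  then obtain B' m where B': "B' \<in> \<B>'" "\<And>k. B k = B' (k + m)"
    using same_curves_shift[OF assms(1)] by blast
  then have "B' (k + m) = Some s"
    using B by simp
  then have "s \<in> dom h" "\<And>t. B' (k + m + 1) = Some t \<Longrightarrow> h s = Some t"
    using assms(2) B'(1) unfolding local_less_def by blast+
  moreover have "B (k + 1) = B' (k + m + 1)"
    unfolding B'(2) by (simp add: ac_simps)
  ultimately show "s \<in> dom h" "B (k + 1) = Some t \<Longrightarrow> h s = Some t" for t
    by metis+
next
  fix p n assume p: "(\<forall>i\<le>n. p i \<in> segments \<B>) \<and> follows h p n"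
  then obtain B' m where B': "B' \<in> \<B>'" "\<forall>i\<le>n. B' (m + int i) = Some (p i)"
    using assms same_curves_segments unfolding local_less_def by metis
  moreover obtain B m' where "B \<in> \<B>" "\<And>k. B' k = B (k + m')"
    using same_curves_shift[OF same_curves_sym[OF assms(1)] B'(1)] by blast
  ultimately have "B \<in> \<B>" "\<forall>i\<le>n. B ((m + m') + int i) = Some (p i)"
    by (simp_all add: algebra_simps)
  then show "\<exists>B\<in>\<B>. \<exists>m. \<forall>i\<le>n. B (m + int i) = Some (p i)"
    by blast
qed

lemma covering_nonempty:
  assumes "covering \<C>"
  shows "\<C> \<noteq> {}"
proof -
  have "(0::complex) \<in> gauss_ints"
    by (simp add: gauss_ints_def)
  then have "\<exists>!(C, k). C \<in> \<C> \<and> (\<exists>s. C k = Some s \<and> support s = closed_segment 0 (0 + 1))"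
    by (rule assms[unfolded covering_def, THEN conjunct2, THEN conjunct1, THEN bspec, THEN bspec]) simp
  from ex1_implies_ex[OF this] show ?thesis
    by auto
qed

text \<open>Consecutive segments of curves of the covering are exactly the paths of
  \<open>nxt\<close>, which translates the condition on runs. An arc is a subcurve because the curve
  through its first segment obeys the same successor map.\<close>

lemma less_curves_iff:
  assumes "covering \<C>" "\<And>B. B \<in> \<B> \<Longrightarrow> arc_curve B"
  shows "less_curves \<B> \<C> \<longleftrightarrow> local_less \<B> (nxt \<C>)"
proof
  assume less: "less_curves \<B> \<C>"
  have sub: "\<exists>C\<in>\<C>. \<exists>m. \<forall>k\<in>dom B. C (k + m) = B k" if "B \<in> \<B>" for B
    using less that unfolding less_curves_def subcurve_def by blast
  have ex: "s \<in> segments \<C>" if "s \<in> segments \<B>" for s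
  proof -
    obtain B k where "B \<in> \<B>" "B k = Some s"
      using \<open>s \<in> segments \<B>\<close> by (rule segmentsE)
    then show ?thesis
      using sub[of B] segmentsI by (metis domI)
  qed
  show "local_less \<B> (nxt \<C>)"
    unfolding local_less_def
  proof (intro conjI ballI allI impI)
    fix B k s assume B: "B \<in> \<B>" "B k = Some s"
    then show "s \<in> dom (nxt \<C>)"
      using ex segmentsI by (metis dom_nxt)
    obtain C m where C: "C \<in> \<C>" "\<And>k. k \<in> dom B \<Longrightarrow> C (k + m) = B k"
      using sub[OF B(1)] by blast
    fix t assume t: "B (k + 1) = Some t"
    then have "C (k + m) = Some s" "C (k + m + 1) = Some t"
      using C(2)[of k] C(2)[of "k + 1"] B(2) by (auto simp: algebra_simps)
    then show "nxt \<C> s = Some t"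
      using nxt_curve[OF assms(1) C(1)] by metis
  next
    fix p n assume p: "(\<forall>i\<le>n. p i \<in> segments \<B>) \<and> follows (nxt \<C>) p n"
    then have "p 0 \<in> segments \<C>"
      using ex by blast
    then obtain C k where C: "C \<in> \<C>" "C k = Some (p 0)"
      by (rule segmentsE)
    have *: "C (k + int i) = Some (p i)" if "i \<le> n" for i
      by (rule follows_nxt_curve[OF assms(1) C p[THEN conjunct2] that])
    have "\<forall>l\<in>{k..k + int n}. \<exists>s\<in>segments \<B>. C l = Some s"
    proof
      fix l assume "l \<in> {k..k + int n}"
      then obtain i where "l = k + int i" "i \<le> n"
        by (metis atLeastAtMost_iff add_le_cancel_left of_nat_le_iff zle_iff_zadd)
      then show "\<exists>s\<in>segments \<B>. C l = Some s"
        using * p by blast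
    qed
    then obtain B m where B: "B \<in> \<B>" "\<forall>l\<in>{k..k + int n}. B (l + m) = C l"
      using less C(1) unfolding less_curves_def by (metis le_add_same_cancel1 of_nat_0_le_iff)
    have "B (k + m + int i) = Some (p i)" if "i \<le> n" for i
      using B(2)[rule_format, of "k + int i"] * that by (simp add: algebra_simps)
    then show "\<exists>B\<in>\<B>. \<exists>m. \<forall>i\<le>n. B (m + int i) = Some (p i)"
      using B(1) by blast
  qed
next
  assume less: "local_less \<B> (nxt \<C>)"
  show "less_curves \<B> \<C>"
    unfolding less_curves_def
  proof (intro conjI ballI allI impI)
    \<comment> \<open>The members of \<open>\<B>\<close> have finite domains; those of
      \<open>\<C>\<close>, of which there is at least one, have domain \<open>UNIV\<close>.\<close>
    show "\<not> same_curves \<B> \<C>"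
    proof
      assume same: "same_curves \<B> \<C>"
      obtain C where C: "C \<in> \<C>"
        using covering_nonempty[OF assms(1)] by blast
      then obtain B m where "B \<in> \<B>" "\<And>k. C k = B (k + m)"
        using same_curves_shift[OF same_curves_sym[OF same]] by blast
      then have "arc_curve C"
        using assms(2) arc_curve_shift by blast
      moreover have "dom C = UNIV"
        using assms(1) C by (auto simp: covering_def complete_curve_def curve_of_def)
      ultimately show False
        unfolding arc_curve_def by (metis finite_atLeastAtMost_int infinite_UNIV_int)
    qed
  next
    fix B assume B: "B \<in> \<B>"
    then obtain i j where ij: "i \<le> j" "dom B = {i..j}"
      using assms(2) unfolding arc_curve_def by blast
    then obtain s where s: "B i = Some s"
      by (metis atLeastAtMost_iff domD order_refl)
    then have "s \<in> segments \<C>"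
      using less B unfolding local_less_def dom_nxt by blast
    then obtain C k where C: "C \<in> \<C>" "C k = Some s"
      by (rule segmentsE)
    define p where "p = (\<lambda>d. the (B (i + int d)))"
    have p: "B (i + int d) = Some (p d)" if "d \<le> nat (j - i)" for d
    proof -
      have "i + int d \<in> dom B"
        using that ij by auto
      then show ?thesis
        unfolding p_def by (metis domIff option.collapse)
    qed
    have f: "follows (nxt \<C>) p (nat (j - i))"
      unfolding follows_def
    proof (intro allI impI)
      fix d assume "d < nat (j - i)"
      then have "B (i + int d) = Some (p d)" "B (i + int d + 1) = Some (p (Suc d))"
        using p[of d] p[of "Suc d"] by (simp_all add: algebra_simps)
      then show "nxt \<C> (p d) = Some (p (Suc d))"
        using less B unfolding local_less_def by blast
    qed
    have k0: "C k = Some (p 0)"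
      using p[of 0] s C(2) by simp
    have Cd: "C (k + int d) = Some (p d)" if "d \<le> nat (j - i)" for d
      by (rule follows_nxt_curve[OF assms(1) C(1) k0 f that])
    have "C (l + (k - i)) = B l" if "l \<in> dom B" for l
    proof -
      have "i \<le> l" "l \<le> j"
        using that unfolding ij(2) by simp_all
      then have "l = i + int (nat (l - i))" "nat (l - i) \<le> nat (j - i)"
        by simp_all
      then obtain d where "l = i + int d" "d \<le> nat (j - i)"
        by blast
      then show ?thesis
        using Cd[of d] p[of d] by (simp add: algebra_simps)
    qed
    then show "\<exists>C\<in>\<C>. subcurve B C"
      using C(1) unfolding subcurve_def by blast
  next
    fix C i j assume C: "C \<in> \<C>" and "i \<le> j \<and> (\<forall>k\<in>{i..j}. \<exists>s\<in>segments \<B>. C k = Some s)"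
    then have ij: "i \<le> j" "\<And>k. k \<in> {i..j} \<Longrightarrow> \<exists>s\<in>segments \<B>. C k = Some s"
      by blast+
    define p where "p = (\<lambda>d. the (C (i + int d)))"
    have p: "C (i + int d) = Some (p d)" "p d \<in> segments \<B>" if "d \<le> nat (j - i)" for d
    proof -
      have "i + int d \<in> {i..j}"
        using that ij(1) by simp
      then obtain s where "s \<in> segments \<B>" "C (i + int d) = Some s"
        using ij(2) by blast
      then show "C (i + int d) = Some (p d)" "p d \<in> segments \<B>"
        by (simp_all add: p_def)
    qed
    have "follows (nxt \<C>) p (nat (j - i))"
      unfolding follows_def
    proof (intro allI impI)
      fix d assume "d < nat (j - i)"
      then have "C (i + int d) = Some (p d)" "C (i + int d + 1) = Some (p (Suc d))"
        using p(1)[of d] p(1)[of "Suc d"] by (simp_all add: algebra_simps)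
      then show "nxt \<C> (p d) = Some (p (Suc d))"
        using nxt_curve[OF assms(1) C] by metis
    qed
    then obtain B m where B: "B \<in> \<B>" "\<And>d. d \<le> nat (j - i) \<Longrightarrow> B (m + int d) = Some (p d)"
      using less p(2) unfolding local_less_def by blast
    have "B (k + (m - i)) = C k" if "k \<in> {i..j}" for k
    proof -
      have "k = i + int (nat (k - i))" "nat (k - i) \<le> nat (j - i)"
        using that by (simp_all add: nat_le_iff)
      then obtain d where "k = i + int d" "d \<le> nat (j - i)"
        by blast
      then show ?thesis
        using B(2)[of d] p(1)[of d] by (simp add: algebra_simps)
    qed
    then show "\<exists>B\<in>\<B>. \<exists>m. \<forall>k\<in>{i..j}. B (k + m) = C k"
      using B(1) by blast
  qed
qed

section \<open>Translations of segments, patterns and flows\<close>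

definition shift_oseg :: "complex \<Rightarrow> oseg \<Rightarrow> oseg" where
  "shift_oseg v s = (fst s + v, snd s)"

definition shift_flow :: "complex \<Rightarrow> (oseg \<Rightarrow> oseg option) \<Rightarrow> oseg \<Rightarrow> oseg option" where
  "shift_flow v h s = map_option (shift_oseg v) (h (shift_oseg (- v) s))"

lemma shift_oseg_simps [simp]:
  "fst (shift_oseg v s) = fst s + v" "snd (shift_oseg v s) = snd s"
  "shift_oseg 0 = id" "shift_oseg v (shift_oseg w s) = shift_oseg (w + v) s"
  "turn (shift_oseg v s) (shift_oseg v t) = turn s t"
  "joins (shift_oseg v s) (shift_oseg v t) = joins s t"
  "shift_oseg v s = shift_oseg v t \<longleftrightarrow> s = t"
  by (auto simp: shift_oseg_def turn_def joins_def prod_eq_iff algebra_simps)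

lemma translate_curve_eq: "translate_curve v C k = map_option (shift_oseg v) (C k)"
  unfolding translate_curve_def shift_oseg_def by (simp add: case_prod_beta')

lemma translate_curve_translate [simp]:
  "translate_curve v (translate_curve w C) = translate_curve (w + v) C"
  "translate_curve 0 C = C"
  by (auto simp: fun_eq_iff translate_curve_eq option.map_comp o_def option.map_id)

lemma shift_flow_shift [simp]: "shift_flow v (shift_flow w h) = shift_flow (w + v) h" "shift_flow 0 h = h"
  by (auto simp: fun_eq_iff shift_flow_def option.map_comp o_def option.map_id algebra_simps)

lemma shift_flow_Some [simp]: "shift_flow v h (shift_oseg v s) = Some (shift_oseg v t) \<longleftrightarrow> h s = Some t"
  by (cases "h s") (auto simp: shift_flow_def)

lemma shift_flow_SomeE:
  assumes "shift_flow v h s = Some t"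
  obtains s' t' where "s = shift_oseg v s'" "t = shift_oseg v t'" "h s' = Some t'"
proof -
  obtain t' where "t = shift_oseg v t'" "h (shift_oseg (- v) s) = Some t'"
    using assms by (auto simp: shift_flow_def)
  then show ?thesis
    using that[of "shift_oseg (- v) s"] by simp
qed

lemma dom_shift_flow: "dom (shift_flow v h) = shift_oseg v ` dom h"
proof
  show "dom (shift_flow v h) \<subseteq> shift_oseg v ` dom h"
    by (force elim: shift_flow_SomeE)
  show "shift_oseg v ` dom h \<subseteq> dom (shift_flow v h)"
  proof
    fix s assume "s \<in> shift_oseg v ` dom h"
    then obtain s' t' where "s = shift_oseg v s'" "h s' = Some t'"
      by auto
    then have "shift_flow v h s = Some (shift_oseg v t')"
      by simp
    then show "s \<in> dom (shift_flow v h)"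
      by blast
  qed
qed

lemma segments_translate: "segments (translate_curve v ` \<B>) = shift_oseg v ` segments \<B>"
proof
  show "segments (translate_curve v ` \<B>) \<subseteq> shift_oseg v ` segments \<B>"
  proof
    fix s assume "s \<in> segments (translate_curve v ` \<B>)"
    then obtain B k s' where "B \<in> \<B>" "B k = Some s'" "s = shift_oseg v s'"
      by (elim segmentsE) (auto simp: translate_curve_eq)
    then show "s \<in> shift_oseg v ` segments \<B>"
      using segmentsI by blast
  qed
  show "shift_oseg v ` segments \<B> \<subseteq> segments (translate_curve v ` \<B>)"
  proof
    fix s assume "s \<in> shift_oseg v ` segments \<B>"
    then obtain B k s' where "B \<in> \<B>" "B k = Some s'" "s = shift_oseg v s'"
      by (elim imageE segmentsE)
    then show "s \<in> segments (translate_curve v ` \<B>)"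
      using segmentsI[of "translate_curve v B" _ k s] by (simp add: translate_curve_eq)
  qed
qed

lemma arc_curve_translate [simp]: "arc_curve (translate_curve v B) \<longleftrightarrow> arc_curve B"
proof -
  have "dom (translate_curve v B) = dom B"
    by (auto simp: translate_curve_eq dom_def)
  then show ?thesis
    by (simp add: arc_curve_def)
qed

lemma follows_shift: "follows (shift_flow v h) p n \<longleftrightarrow> follows h (\<lambda>i. shift_oseg (- v) (p i)) n"
proof -
  have "shift_flow v h s = Some t \<longleftrightarrow> h (shift_oseg (- v) s) = Some (shift_oseg (- v) t)" for s t
    using shift_flow_Some[of v h "shift_oseg (- v) s" "shift_oseg (- v) t"] by simp
  then show ?thesis
    by (simp add: follows_def)
qed

lemma local_less_translate:
  "local_less (translate_curve v ` \<B>) (shift_flow v h) \<longleftrightarrow> local_less \<B> h"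
proof -
  have *: "local_less (translate_curve v ` \<B>) (shift_flow v h)" if less: "local_less \<B> h" for v \<B> h
    unfolding local_less_def
  proof (intro conjI ballI allI impI)
    fix C k s assume "C \<in> translate_curve v ` \<B>" "C k = Some s"
    then obtain B s' where B: "B \<in> \<B>" "C = translate_curve v B" "B k = Some s'" "s = shift_oseg v s'"
      by (auto simp: translate_curve_eq)
    then have "s' \<in> dom h" and n: "\<And>t. B (k + 1) = Some t \<Longrightarrow> h s' = Some t"
      using that unfolding local_less_def by blast+
    then show "s \<in> dom (shift_flow v h)"
      by (simp add: dom_shift_flow B)
    show "shift_flow v h s = Some t" if "C (k + 1) = Some t" for t
      using that n by (auto simp: B translate_curve_eq)
  next
    fix p n
    assume p: "(\<forall>i\<le>n. p i \<in> segments (translate_curve v ` \<B>)) \<and> follows (shift_flow v h) p n"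
    then have "\<forall>i\<le>n. shift_oseg (- v) (p i) \<in> segments \<B>"
      unfolding segments_translate by fastforce
    then obtain B m where "B \<in> \<B>" "\<forall>i\<le>n. B (m + int i) = Some (shift_oseg (- v) (p i))"
      using less[unfolded local_less_def, THEN conjunct2, rule_format, of n "\<lambda>i. shift_oseg (- v) (p i)"] p
      unfolding follows_shift by blast
    then show "\<exists>B\<in>translate_curve v ` \<B>. \<exists>m. \<forall>i\<le>n. B (m + int i) = Some (p i)"
      by (intro bexI[of _ "translate_curve v B"] exI[of _ m]) (simp_all add: translate_curve_eq)
  qed
  show ?thesis
    using *[of \<B> h v] *[of "translate_curve v ` \<B>" "shift_flow v h" "- v"]
    by (auto simp: image_image)
qed

text \<open>The translation changes the parity of \<open>x + y\<close> by that of
  \<open>p + q\<close>, so the bit flips exactly when \<open>p + q\<close> is odd.\<close>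

lemma oriented_shift:
  assumes "oriented G b"
  shows "oriented (shift_oseg (of_int p + \<i> * of_int q) ` G) (b = even (p + q))"
  unfolding oriented_def Let_def
proof (intro allI)
  fix x y :: int
  define v where "v = of_int p + \<i> * of_int q"
  define z where "z = of_int x + \<i> * of_int y"
  have z: "z - v = of_int (x - p) + \<i> * of_int (y - q)"
    by (simp add: z_def v_def algebra_simps)
  have "{s \<in> shift_oseg v ` G. fst s = z \<or> fst s + snd s = z} =
    shift_oseg v ` {s \<in> G. fst s = z - v \<or> fst s + snd s = z - v}"
    by (auto simp: algebra_simps)
  also have "\<dots> = shift_oseg v ` (if even (x - p + (y - q)) = b then horizontal_out (z - v) else vertical_out (z - v))"
    using assms unfolding oriented_def z Let_def by presburger
  also have "\<dots> = (if even (x - p + (y - q)) = b then horizontal_out z else vertical_out z)"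
    by (simp add: horizontal_out_def vertical_out_def shift_oseg_def)
  also have "(even (x - p + (y - q)) = b) \<longleftrightarrow> (even (x + y) = (b = even (p + q)))"
    by auto
  finally show "{s \<in> shift_oseg v ` G. fst s = z \<or> fst s + snd s = z} =
     (if even (x + y) = (b = even (p + q)) then horizontal_out z else vertical_out z)" .
qed

lemma shift_oseg_osegs: "v \<in> gauss_ints \<Longrightarrow> s \<in> osegs \<Longrightarrow> shift_oseg v s \<in> osegs"
  by (auto simp: osegs_def shift_oseg_def gauss_ints_add)

lemma flow_shift:
  assumes "flow h" "v \<in> gauss_ints"
  shows "flow (shift_flow v h)"
proof -
  interpret flow h by fact
  show ?thesis
  proof
    show "dom (shift_flow v h) \<subseteq> osegs"
      using dom_osegs shift_oseg_osegs[OF assms(2)] by (auto simp: dom_shift_flow)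
    show "\<exists>b. oriented (dom (shift_flow v h)) b"
      using orientation oriented_shift assms(2) unfolding dom_shift_flow gauss_ints_iff by metis
    show "joins s t \<and> t \<in> dom (shift_flow v h)" if "shift_flow v h s = Some t" for s t
      using that step by (auto simp: dom_shift_flow elim!: shift_flow_SomeE)
    show "s = s'" if "shift_flow v h s = Some t" "shift_flow v h s' = Some t" for s s' t
      using that inj by (auto elim!: shift_flow_SomeE)
    show "\<exists>s. shift_flow v h s = Some t" if "t \<in> dom (shift_flow v h)" for t
      using that surj shift_flow_Some unfolding dom_shift_flow by blast
    show "p n \<noteq> p 0" if "follows (shift_flow v h) p n" "0 < n" for p n
      using acyclic[OF that[unfolded follows_shift]] by auto
    show "\<exists>N S. folding N S \<and> sublist (map (\<lambda>i. turn (p i) (p (Suc i))) [0..<n]) S"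
      if "follows (shift_flow v h) p n" for p n
      using foldings[OF that[unfolded follows_shift]] by simp
  qed
qed

section \<open>Limits of flows\<close>

text \<open>Each axiom is tested on finitely many segments. Two of them assert existence and take an
  argument: a predecessor has only two candidates, and the parity bit is read off from the fixed
  segment \<open>(0, 1)\<close>, so that it does not vary with the approximant.\<close>

lemma flow_limit:
  assumes "dom h \<subseteq> osegs"
    and approx: "\<And>F. finite F \<Longrightarrow> F \<subseteq> osegs \<Longrightarrow> \<exists>h'. flow h' \<and> (\<forall>s\<in>F. h' s = h s)"
  shows "flow h"
proof
  show "dom h \<subseteq> osegs" by fact
  show "joins s t \<and> t \<in> dom h" if st: "h s = Some t" for s t
  proof -
    have s: "s \<in> osegs"
      using st assms(1) by blast
    \<comment> \<open>\<open>approx\<close> accepts only subsets of \<open>osegs\<close>, so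
      \<open>t \<in> osegs\<close> must be known before \<open>t\<close> can be added to the
      set.\<close>
    then obtain h1 where "flow h1" "h1 s = Some t"
      using approx[of "{s}"] st by auto
    then have "t \<in> osegs"
      using flow.step flow.dom_osegs by blast
    then obtain h2 where "flow h2" "h2 s = Some t" "h2 t = h t"
      using approx[of "{s, t}"] st s by auto
    then show ?thesis
      using flow.step[of h2 s t] by (auto simp: domIff)
  qed
  show "s = s'" if st: "h s = Some t" "h s' = Some t" for s s' t
  proof -
    have "{s, s'} \<subseteq> osegs"
      using st assms(1) by blast
    then obtain h' where "flow h'" "h' s = Some t" "h' s' = Some t"
      using approx[of "{s, s'}"] st by auto
    then show ?thesis
      using flow.inj by blast
  qed
  show "\<exists>s. h s = Some t" if t: "t \<in> dom h" for t
  proof -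
    have t': "t \<in> osegs"
      using assms(1) t by blast
    \<comment> \<open>The only possible predecessors of \<open>t\<close>: the two perpendicular
      segments that end at its initial point.\<close>
    define P where "P = (\<lambda>d. (fst t - d, d)) ` {\<i> * snd t, - \<i> * snd t}"
    have "P \<subseteq> osegs"
      using t' unfolding P_def osegs_def
      by (auto simp: mem_Times_iff gauss_ints_def)
    then obtain h' where h': "flow h'" "h' t = h t" "\<And>s. s \<in> P \<Longrightarrow> h' s = h s"
      using approx[of "insert t P"] t' by (auto simp: P_def)
    then obtain s where s: "h' s = Some t"
      using flow.surj[of h' t] t by (auto simp: domIff)
    then have "joins s t"
      using flow.step h'(1) by blast
    then have "fst s = fst t - snd s" "snd s \<in> {\<i> * snd t, - \<i> * snd t}"
      by (auto simp: joins_def)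
    then have "s \<in> P"
      unfolding P_def by (intro image_eqI[where x = "snd s"]) (simp_all add: prod_eq_iff)
    then show ?thesis
      using h'(3) s by metis
  qed
  have path: "\<exists>h'. flow h' \<and> follows h' p n" if "follows h p n" for p n
  proof -
    have "p ` {..<n} \<subseteq> osegs"
      using that assms(1) unfolding follows_def by blast
    then obtain h' where "flow h'" "\<forall>i<n. h' (p i) = h (p i)"
      using approx[of "p ` {..<n}"] by auto
    then show ?thesis
      using that unfolding follows_def by metis
  qed
  show "p n \<noteq> p 0" if "follows h p n" "0 < n" for p n
    using path that flow.acyclic by blast
  show "\<exists>N S. folding N S \<and> sublist (map (\<lambda>i. turn (p i) (p (Suc i))) [0..<n]) S"
    if "follows h p n" for p n
    using path[OF that] flow.foldings by blast
  show "\<exists>b. oriented (dom h) b"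
  proof
    show "oriented (dom h) ((0, 1) \<in> dom h)"
      unfolding oriented_def Let_def
    proof (intro allI)
      fix x y :: int
      define z where "z = of_int x + \<i> * of_int y"
      \<comment> \<open>The eight oriented segments at \<open>z\<close>, together with
        \<open>(0, 1)\<close>, which determines the parity bit.\<close>
      define F where "F = insert (0, 1) ((\<lambda>u. (z, u)) ` {1, -1, \<i>, -\<i>} \<union> (\<lambda>u. (z - u, u)) ` {1, -1, \<i>, -\<i>})"
      have "F \<subseteq> osegs"
        by (auto simp: F_def osegs_def gauss_ints_def z_def)
      moreover have "finite F"
        by (simp add: F_def)
      ultimately obtain h' where h': "flow h'" "\<forall>s\<in>F. h' s = h s"
        using approx by blast
      have incident: "s \<in> F" if "s \<in> osegs" "fst s = z \<or> fst s + snd s = z" for s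
      proof -
        have "snd s \<in> {1, -1, \<i>, -\<i>}" "s = (z, snd s) \<or> s = (z - snd s, snd s)"
          using that by (auto simp: osegs_def prod_eq_iff)
        then show ?thesis
          unfolding F_def by blast
      qed
      have dom_eq: "s \<in> dom h' \<longleftrightarrow> s \<in> dom h" if "s \<in> F" for s
        using h'(2) that by (simp add: domIff)
      obtain b where b: "oriented (dom h') b"
        using flow.orientation[OF h'(1)] by blast
      have "{s \<in> dom h'. fst s = 0 \<or> fst s + snd s = 0} =
          (if b then horizontal_out 0 else vertical_out 0)"
        using b[unfolded oriented_def Let_def, rule_format, of 0 0] by simp
      moreover have "(0, 1) \<in> horizontal_out 0" "(0, 1) \<notin> vertical_out 0"
        by (auto simp: horizontal_out_def vertical_out_def complex_eq_iff)
      ultimately have "(0, 1) \<in> dom h' \<longleftrightarrow> b"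
        by (metis (mono_tags, lifting) fst_conv mem_Collect_eq)
      then have b_eq: "b = ((0, 1) \<in> dom h)"
        using dom_eq[of "(0, 1)"] by (simp add: F_def)
      have "{s \<in> dom h. fst s = z \<or> fst s + snd s = z} = {s \<in> dom h'. fst s = z \<or> fst s + snd s = z}"
        using incident dom_eq assms(1) flow.dom_osegs[OF h'(1)] by blast
      also have "\<dots> = (if even (x + y) = b then horizontal_out z else vertical_out z)"
        using b unfolding oriented_def Let_def z_def by blast
      finally show "{s \<in> dom h. fst s = z \<or> fst s + snd s = z} =
          (if even (x + y) = ((0, 1) \<in> dom h) then horizontal_out z else vertical_out z)"
        unfolding b_eq .
    qed
  qed
qed

text \<open>A diagonal argument with nested infinite index sets \<open>A k\<close>; each step fixes
  the value at one more point by the pigeonhole principle. Infinitely many agreeing indices, rather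
  than one, later allow approximants of large index, whose half-curves are long.\<close>

lemma pointwise_limit:
  fixes f :: "nat \<Rightarrow> 'a \<Rightarrow> 'b"
  assumes "countable L" and fin: "\<And>s. s \<in> L \<Longrightarrow> finite (range (\<lambda>n. f n s))"
  shows "\<exists>g. \<forall>F. finite F \<and> F \<subseteq> L \<longrightarrow> infinite {n. \<forall>s\<in>F. f n s = g s}"
proof (cases "L = {}")
  case False
  define e where "e = from_nat_into L"
  have e: "e k \<in> L" for k
    using False from_nat_into e_def by metis
  have "\<exists>A. \<forall>k. infinite (A k) \<and> (A (Suc k) \<subseteq> A k \<and> (\<exists>c. \<forall>n\<in>A (Suc k). f n (e k) = c))"
  proof (rule dependent_nat_choice)
    show "\<exists>x::nat set. infinite x"
      using infinite_UNIV_nat by blast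
    fix A :: "nat set" and k assume A: "infinite A"
    have "finite ((\<lambda>n. f n (e k)) ` A)"
      using fin[OF e] by (rule rev_finite_subset) auto
    then obtain m where "infinite {n \<in> A. f n (e k) = f m (e k)}"
      using pigeonhole_infinite[OF A] by blast
    then show "\<exists>B. infinite B \<and> B \<subseteq> A \<and> (\<exists>c. \<forall>n\<in>B. f n (e k) = c)"
      by (intro exI[of _ "{n \<in> A. f n (e k) = f m (e k)}"]) auto
  qed
  then obtain A c where A: "\<And>k. infinite (A k)" "\<And>k. A (Suc k) \<subseteq> A k"
    and c: "\<And>k n. n \<in> A (Suc k) \<Longrightarrow> f n (e k) = c k"
    by metis
  have anti: "A l \<subseteq> A k" if "k \<le> l" for k l
    using lift_Suc_antimono_le[of A] A(2) that by blast
  show ?thesis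
  proof (intro exI allI impI)
    fix F assume F: "finite F \<and> F \<subseteq> L"
    define K where "K = Suc (Max (insert 0 (to_nat_on L ` F)))"
    have "\<forall>s\<in>F. f n s = c (to_nat_on L s)" if "n \<in> A K" for n
    proof
      fix s assume s: "s \<in> F"
      then have "to_nat_on L s \<le> Max (insert 0 (to_nat_on L ` F))"
        using F by simp
      then have "n \<in> A (Suc (to_nat_on L s))"
        using anti[of "Suc (to_nat_on L s)" K] that by (auto simp: K_def)
      then have "f n (e (to_nat_on L s)) = c (to_nat_on L s)"
        by (rule c)
      then show "f n s = c (to_nat_on L s)"
        using from_nat_into_to_nat_on[OF assms(1)] s F by (auto simp: e_def)
    qed
    then have "A K \<subseteq> {n. \<forall>s\<in>F. f n s = c (to_nat_on L s)}"
      by blast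
    then show "infinite {n. \<forall>s\<in>F. f n s = c (to_nat_on L s)}"
      using A(1) finite_subset by blast
  qed
qed auto

lemma countable_osegs: "countable osegs"
proof -
  have "gauss_ints \<subseteq> (\<lambda>(x, y). of_int x + \<i> * of_int y) ` (UNIV :: (int \<times> int) set)"
    using gauss_ints_iff by fastforce
  then have "countable gauss_ints"
    by (rule countable_subset) simp
  then show ?thesis
    unfolding osegs_def by simp
qed

text \<open>A flow leaves a segment at most two successors, so every point has at most three
  possible values, \<open>None\<close> included.\<close>

lemma flow_sequence_limit:
  fixes h :: "nat \<Rightarrow> oseg \<Rightarrow> oseg option"
  assumes "\<And>n. flow (h n)"
  shows "\<exists>g. flow g \<and> (\<forall>F. finite F \<longrightarrow> infinite {n::nat. \<forall>s\<in>F. h n s = g s})"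
proof -
  have "finite (range (\<lambda>n. h n s))" for s
  proof (rule finite_subset)
    show "range (\<lambda>n. h n s) \<subseteq>
      {None, Some (fst s + snd s, \<i> * snd s), Some (fst s + snd s, - \<i> * snd s)}"
    proof
      fix r assume "r \<in> range (\<lambda>n. h n s)"
      then obtain n where n: "r = h n s"
        by blast
      show "r \<in> {None, Some (fst s + snd s, \<i> * snd s), Some (fst s + snd s, - \<i> * snd s)}"
      proof (cases r)
        case (Some t)
        then have "joins s t"
          using flow.step[OF assms] n by metis
        then show ?thesis
          using Some by (cases t) (auto simp: joins_def)
      qed simp
    qed
  qed simp
  then obtain g where g: "\<And>F. finite F \<Longrightarrow> F \<subseteq> osegs \<Longrightarrow> infinite {n. \<forall>s\<in>F. h n s = g s}"
    using pointwise_limit[OF countable_osegs, of h] by blast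
  \<comment> \<open>Nothing is known about \<open>g\<close> outside \<open>osegs\<close>, where
    every \<open>h n\<close> is \<open>None\<close>.\<close>
  define g' where "g' = g |` osegs"
  have h_None: "h n s = None" if "s \<notin> osegs" for n s
    using flow.dom_osegs[OF assms] that by blast
  have *: "infinite {n. \<forall>s\<in>F. h n s = g' s}" if "finite F" for F :: "oseg set"
  proof -
    have "h n s = g' s" if "\<forall>s\<in>F \<inter> osegs. h n s = g s" "s \<in> F" for n s
      using that h_None by (cases "s \<in> osegs") (simp_all add: g'_def)
    then have "{n. \<forall>s\<in>F \<inter> osegs. h n s = g s} \<subseteq> {n. \<forall>s\<in>F. h n s = g' s}"
      by blast
    then show ?thesis
      using g[of "F \<inter> osegs"] that finite_subset by blast
  qed
  have "flow g'"
  proof (rule flow_limit)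
    show "dom g' \<subseteq> osegs"
      by (simp add: g'_def)
    fix F :: "oseg set" assume "finite F"
    then obtain n where "\<forall>s\<in>F. h n s = g' s"
      using * by (metis (mono_tags, lifting) empty_Collect_eq finite.emptyI)
    then show "\<exists>h'. flow h' \<and> (\<forall>s\<in>F. h' s = g' s)"
      using assms by blast
  qed
  then show ?thesis
    using * by blast
qed

section \<open>Points where four equal half-curves meet\<close>

lemma folding_set: "folding n S \<Longrightarrow> set S \<subseteq> {1, -1}"
  by (induction rule: folding.induct) (auto simp: bar_def)

text \<open>The displacement along a path with turns \<open>S\<close> whose first segment is \<open>1\<close>.\<close>

fun disp :: "int list \<Rightarrow> complex" where
  "disp [] = 1"
| "disp (t # S) = 1 + \<i> powi t * disp S"

lemma disp_append: "disp (S @ t # R) = disp S + \<i> powi sum_list S * \<i> powi t * disp R"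
  by (induction S) (auto simp: power_int_add algebra_simps)

lemma sum_list_bar [simp]: "sum_list (bar S) = - sum_list S"
  by (induction S) auto

lemma i_powi_minus_mult [simp]: "\<i> powi t * \<i> powi (- t) = 1"
  by (simp add: power_int_minus)

text \<open>Run backwards, the path with turns \<open>S\<close> and first segment 1 has turns
  \<open>bar S\<close>, first segment \<open>- (\<i> powi sum_list S)\<close> and displacement
  \<open>- disp S\<close>.\<close>

lemma disp_bar: "\<i> powi sum_list S * disp (bar S) = disp S"
proof (induction S)
  case (Cons t S)
  have "\<i> powi (t + sum_list S) * disp (bar S @ [- t]) =
    \<i> powi t * (\<i> powi sum_list S * disp (bar S)) +
    (\<i> powi t * \<i> powi (- t)) * (\<i> powi sum_list S * \<i> powi (- sum_list S))"
    by (simp add: disp_append power_int_add algebra_simps del: i_powi_minus_mult)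
  then show ?case
    unfolding i_powi_minus_mult Cons by simp
qed simp

text \<open>Four copies of the same stroke, each a quarter turn after the other.\<close>

lemma disp_square:
  assumes "t \<in> {1, -1}"
  shows "disp (S @ t # bar S @ t # S @ t # bar S) = 0"
proof -
  define j where "j = \<i> powi t"
  define E where "E = \<i> powi sum_list S"
  define E' where "E' = \<i> powi (- sum_list S)"
  have j: "j * j = -1"
    using assms by (auto simp: j_def)
  have EE': "E * E' = 1"
    unfolding E_def E'_def by (rule i_powi_minus_mult)
  have "disp (S @ t # bar S @ t # S @ t # bar S) =
      disp S + E * j * (disp (bar S) + E' * j * (disp S + E * j * disp (bar S)))"
    by (simp add: disp_append j_def E_def E'_def)
  \<comment> \<open>With \<open>E * disp (bar S) = disp S\<close> and \<open>E * E' = 1\<close> this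
    becomes \<open>(1 + j) * (1 + j * j) * disp S\<close>.\<close>
  also have "\<dots> = disp S + j * (E * disp (bar S)) + (j * j) * (E * E') * (disp S + j * (E * disp (bar S)))"
    by (simp add: algebra_simps)
  also have "\<dots> = 0"
    unfolding j EE' disp_bar[of S, folded E_def] by (simp add: algebra_simps)
  finally show ?thesis .
qed

text \<open>The turns are indexed from 0: \<open>a i\<close> is taken between segments
  \<open>i\<close> and \<open>i + 1\<close>. With \<open>(!) S\<close> for \<open>a\<close>, only
  segments up to index \<open>length S\<close> are meaningful.\<close>

fun walk :: "complex \<Rightarrow> complex \<Rightarrow> (nat \<Rightarrow> int) \<Rightarrow> nat \<Rightarrow> oseg" where
  "walk x e a 0 = (x, e)"
| "walk x e a (Suc i) = (fst (walk x e a i) + snd (walk x e a i), \<i> powi a i * snd (walk x e a i))"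

text \<open>The orientation of the covering forces two of the four half-curves at a vertex to be run
  through backwards.\<close>

definition traced :: "(oseg \<Rightarrow> oseg option) \<Rightarrow> (nat \<Rightarrow> oseg) \<Rightarrow> nat \<Rightarrow> bool" where
  "traced h p n \<longleftrightarrow> follows h p n \<or>
     (\<forall>i<n. h (oseg_reverse (p (Suc i))) = Some (oseg_reverse (p i)))"

lemma oseg_reverse_reverse [simp]: "oseg_reverse (oseg_reverse s) = s"
  by (simp add: oseg_reverse_def)

context
  fixes c :: "int \<Rightarrow> oseg" and a :: "int \<Rightarrow> int"
  assumes c: "\<And>k. fst (c (k + 1)) = fst (c k) + snd (c k)"
    "\<And>k. snd (c (k + 1)) = \<i> powi a k * snd (c k)"
begin

lemma curve_disp:
  assumes "\<And>i. i < length S \<Longrightarrow> a (k + int i) = S ! i"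
  shows "fst (c (k + int (length S) + 1)) = fst (c k) + snd (c k) * disp S"
  using assms
proof (induction S arbitrary: k)
  case (Cons t S)
  have "a (k + 1 + int i) = S ! i" if "i < length S" for i
    using Cons.prems[of "Suc i"] that by (simp add: algebra_simps)
  then have "fst (c (k + 1 + int (length S) + 1)) = fst (c (k + 1)) + snd (c (k + 1)) * disp S"
    by (rule Cons.IH)
  moreover have "a k = t"
    using Cons.prems[of 0] by simp
  ultimately show ?case
    using c[of k] by (simp add: algebra_simps)
qed (simp add: c)

lemma walk_forward:
  assumes "\<And>i. i < n \<Longrightarrow> a (k + int i) = S i" "i \<le> n"
  shows "walk (fst (c k)) (snd (c k)) S i = c (k + int i)"
  using assms(2)
proof (induction i)
  case (Suc i)
  then show ?case
    using c[of "k + int i"] assms(1)[of i] by (simp add: prod_eq_iff algebra_simps)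
qed simp

text \<open>Backwards, the turns come in reverse order and with opposite sign; the one met on
  leaving segment \<open>k\<close> is \<open>a (k - 1)\<close>.\<close>

lemma walk_backward:
  assumes "\<And>i. i < n \<Longrightarrow> a (k - 1 - int i) = - S i" "i \<le> n"
  shows "walk (fst (c k) + snd (c k)) (- snd (c k)) S i = oseg_reverse (c (k - int i))"
  using assms(2)
proof (induction i)
  case (Suc i)
  define l where "l = k - 1 - int i"
  have l: "k - int i = l + 1" "k - int (Suc i) = l"
    by (simp_all add: l_def)
  have "a l = - S i"
    using assms(1) Suc by (simp add: l_def)
  then have "snd (c l) = \<i> powi S i * snd (c (l + 1))"
    using i_powi_minus_mult[of "S i"] by (simp add: c(2) mult.assoc[symmetric])
  then show ?case
    using Suc c(1)[of l] unfolding l by (simp add: oseg_reverse_def)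
qed (simp add: oseg_reverse_def)

end

lemma nth_append_middle: "i < length Y \<Longrightarrow> (X @ Y @ Z) ! (length X + i) = Y ! i"
  by (simp add: nth_append)

lemma ex_fourfold_point:
  assumes cov: "covering \<C>" and "\<forall>C\<in>\<C>. complete_folding_curve C"
  shows "\<exists>x\<in>gauss_ints. \<exists>S. folding n S \<and>
    (\<forall>e\<in>{1, -1, \<i>, -\<i>}. traced (nxt \<C>) (walk x e ((!) S)) (2 ^ n - 1))"
proof -
  obtain C where C: "C \<in> \<C>"
    using covering_nonempty[OF cov] by blast
  obtain c where Cc: "C = Some \<circ> c"
    using covering_curve_total[OF cov C] .
  obtain a where a: "complete_folding a" "curve_of UNIV a C"
    using assms(2) C unfolding complete_folding_curve_def by blast
  have c: "fst (c (k + 1)) = fst (c k) + snd (c k)" "snd (c (k + 1)) = \<i> powi a k * snd (c k)" for k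
    using a(2) unfolding curve_of_def Cc by (metis comp_apply prod.collapse)+
  have osegs: "c k \<in> osegs" for k
    using covering_joins(2)[OF cov C, of k "c k" "c (k + 1)"] by (simp add: Cc)
  have nxt: "nxt \<C> (c k) = Some (c (k + 1))" for k
    using nxt_curve[OF cov C, of k "c k"] by (simp add: Cc)
  have inj: "k = l" if "support (c k) = support (c l)" for k l
    using covering_unique(2)[OF cov C C _ _ that, of k l] by (simp add: Cc)
  obtain S u t v k0 where S: "folding n S" and t: "t \<in> {1, -1}"
    and pat: "\<And>i. i < 6 * 2 ^ n - 1 \<Longrightarrow> a (k0 + int i) =
       (bar S @ u # S @ t # bar S @ t # S @ t # bar S @ v # S) ! i"
    using complete_folding_pattern[OF a(1), of n] by blast
  define M :: nat where "M = 2 ^ n"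
  have M: "length S + 1 = M" "0 < M"
    using length_folding[OF S] by (simp_all add: M_def)
  have len: "M - 1 = length S" "int M = int (length S) + 1"
    using M(1) by auto
  have block: "a (k0 + int (length X + i)) = Y ! i"
    if "X @ Y @ Z = bar S @ u # S @ t # bar S @ t # S @ t # bar S @ v # S" "i < length Y" for X Y Z i
  proof -
    have "length X + i < length (X @ Y @ Z)"
      using that(2) by simp
    also have "\<dots> = 6 * M - 1"
      unfolding that(1) using M(1) by simp
    finally show ?thesis
      using pat[of "length X + i", folded that(1)] nth_append_middle[OF that(2)] by (simp add: M_def)
  qed
  \<comment> \<open>Segment \<open>k\<close> leaves the meeting point after the turn
    \<open>u = a (k - 1)\<close>, and segment \<open>k'\<close> after \<open>v = a (k' - 1)\<close>;
    in between lie four strokes of \<open>M\<close> segments each.\<close>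
  define k where "k = k0 + int M"
  define k' where "k' = k + 4 * int M"
  have fwd: "a (k + int i) = S ! i" "a (k' + int i) = S ! i" if "i < M - 1" for i
    using block[of "bar S @ [u]" S "t # bar S @ t # S @ t # bar S @ v # S" i]
      block[of "bar S @ u # S @ t # bar S @ t # S @ t # bar S @ [v]" S "[]" i] that[unfolded len]
    by (simp_all add: len k_def k'_def algebra_simps)
  have bwd0: "a (k0 + int i) = bar S ! i" "a (k0 + 4 * int M + int i) = bar S ! i" if "i < M - 1" for i
    using block[of "[]" "bar S" "u # S @ t # bar S @ t # S @ t # bar S @ v # S" i]
      block[of "bar S @ u # S @ t # bar S @ t # S @ [t]" "bar S" "v # S" i] that[unfolded len]
    by (simp_all add: len algebra_simps)
  \<comment> \<open>Backwards from segment \<open>k - 1\<close> or \<open>k' - 1\<close> the terms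
    of \<open>bar S\<close> are met from its end, and these are the negatives of the terms of
    \<open>S\<close> in order.\<close>
  have bwd: "a (k - 1 - 1 - int i) = - S ! i" "a (k' - 1 - 1 - int i) = - S ! i" if "i < M - 1" for i
  proof -
    define j where "j = M - 2 - i"
    have j: "j < M - 1" "int j = int M - 2 - int i" "length S - Suc j = i"
      using that M by (auto simp: j_def)
    then have "bar S ! j = - S ! i"
      using nth_bar[of j S] M by simp
    then show "a (k - 1 - 1 - int i) = - S ! i" "a (k' - 1 - 1 - int i) = - S ! i"
      using bwd0[OF j(1)] j(2) by (simp_all add: k_def k'_def algebra_simps)
  qed
  let ?W = "S @ t # bar S @ t # S @ t # bar S"
  have "a (k + int i) = ?W ! i" if "i < length ?W" for i
    using block[of "bar S @ [u]" ?W "v # S" i] that by (simp add: len k_def algebra_simps)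
  then have "fst (c (k + int (length ?W) + 1)) = fst (c k) + snd (c k) * disp ?W"
    by (rule curve_disp[of c a, OF c])
  moreover have "k + int (length ?W) + 1 = k'"
    using M by (simp add: k'_def)
  ultimately have closed: "fst (c k') = fst (c k)"
    by (simp add: disp_square[OF t])
  define x where "x = fst (c k)"
  have x: "fst (c k) = x" "fst (c k') = x" "fst (c (k - 1)) + snd (c (k - 1)) = x"
    "fst (c (k' - 1)) + snd (c (k' - 1)) = x"
    using closed c(1)[of "k - 1"] c(1)[of "k' - 1"] by (simp_all add: x_def)
  have traced: "traced (nxt \<C>) (walk x (snd (c l)) ((!) S)) (M - 1)"
    if "\<And>i. i < M - 1 \<Longrightarrow> a (l + int i) = S ! i" "fst (c l) = x" for l
  proof -
    have "walk x (snd (c l)) ((!) S) i = c (l + int i)" if "i \<le> M - 1" for i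
      using walk_forward[of c a "M - 1" l "(!) S" i, OF c] \<open>fst (c l) = x\<close>
        \<open>\<And>i. i < M - 1 \<Longrightarrow> a (l + int i) = S ! i\<close> that by simp
    then have "follows (nxt \<C>) (walk x (snd (c l)) ((!) S)) (M - 1)"
      using nxt unfolding follows_def by (simp add: algebra_simps del: walk.simps)
    then show ?thesis
      by (simp add: traced_def)
  qed
  have traced_rev: "traced (nxt \<C>) (walk x (- snd (c l)) ((!) S)) (M - 1)"
    if "\<And>i. i < M - 1 \<Longrightarrow> a (l - 1 - int i) = - S ! i" "fst (c l) + snd (c l) = x" for l
  proof -
    have "walk x (- snd (c l)) ((!) S) i = oseg_reverse (c (l - int i))" if "i \<le> M - 1" for i
      using walk_backward[of c a "M - 1" l "(!) S" i, OF c] \<open>fst (c l) + snd (c l) = x\<close>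
        \<open>\<And>i. i < M - 1 \<Longrightarrow> a (l - 1 - int i) = - S ! i\<close> that by simp
    moreover have "nxt \<C> (c (l - int (Suc i))) = Some (c (l - int i))" for i
      using nxt[of "l - int (Suc i)"] by simp
    ultimately show ?thesis
      by (simp add: traced_def del: walk.simps of_nat_Suc)
  qed
  \<comment> \<open>The directions in which the four half-curves leave \<open>x\<close>. The edges
    belong to four different indices of one curve, hence are distinct, so these directions exhaust
    the four units.\<close>
  define U where "U = {snd (c k), snd (c k'), - snd (c (k - 1)), - snd (c (k' - 1))}"
  have "support (c k) = closed_segment x (x + snd (c k))"
    "support (c k') = closed_segment x (x + snd (c k'))"
    "support (c (k - 1)) = closed_segment x (x + - snd (c (k - 1)))"
    "support (c (k' - 1)) = closed_segment x (x + - snd (c (k' - 1)))"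
    using x by (auto simp: support_def closed_segment_commute algebra_simps)
  moreover have "k \<noteq> k'" "k \<noteq> k - 1" "k \<noteq> k' - 1" "k' \<noteq> k - 1" "k' \<noteq> k' - 1" "k - 1 \<noteq> k' - 1"
    using M(2) by (auto simp: k'_def)
  ultimately have "card U = 4"
    unfolding U_def using inj by (subst card_insert_disjoint, simp, metis insertE singletonD)+ simp
  moreover have "snd (c l) \<in> {1, -1, \<i>, -\<i>}" "- snd (c l) \<in> {1, -1, \<i>, -\<i>}" for l
    using osegs[of l] by (auto simp: osegs_def)
  then have "U \<subseteq> {1, -1, \<i>, -\<i>}"
    unfolding U_def by blast
  moreover have "card {1, -1, \<i>, -\<i>} = 4"
    by (simp add: complex_eq_iff)
  ultimately have U: "U = {1, -1, \<i>, -\<i>}"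
    by (intro card_subset_eq) auto
  have "\<forall>e\<in>U. traced (nxt \<C>) (walk x e ((!) S)) (M - 1)"
    unfolding U_def using traced[OF fwd(1) x(1)] traced[OF fwd(2) x(2)]
      traced_rev[OF bwd(1) x(3)] traced_rev[OF bwd(2) x(4)] by blast
  moreover have "x \<in> gauss_ints"
    using osegs[of k] by (auto simp: x_def osegs_def)
  ultimately show ?thesis
    using S unfolding U M_def by blast
qed

section \<open>The limit covering\<close>

lemma walk_shift: "walk (x + v) e a i = shift_oseg v (walk x e a i)"
  by (induction i) (auto simp: shift_oseg_def)

lemma walk_rotate: "walk 0 (u * e) a i = (u * fst (walk 0 e a i), u * snd (walk 0 e a i))"
  by (induction i) (auto simp: algebra_simps)

lemma shift_oseg_reverse: "oseg_reverse (shift_oseg v s) = shift_oseg v (oseg_reverse s)"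
  by (simp add: oseg_reverse_def shift_oseg_def)

lemma traced_shift: "traced (shift_flow v h) (\<lambda>i. shift_oseg v (p i)) n \<longleftrightarrow> traced h p n"
  by (simp add: traced_def follows_def shift_oseg_reverse)

lemma bounded_curves_arc:
  assumes "bounded_curves \<B>" "B \<in> \<B>"
  shows "arc_curve B"
proof -
  have "is_curve B" "finite (dom B)"
    using assms by (auto simp: bounded_curves_def)
  then have "(\<exists>n\<ge>1. dom B = {1..n}) \<or> dom B = {1..} \<or> dom B = UNIV"
    unfolding is_curve_def curve_of_def by metis
  then have "\<exists>n\<ge>1. dom B = {1..n}"
    using \<open>finite (dom B)\<close> infinite_Ici[of "1::int"] infinite_UNIV_int by (elim disjE) simp_all
  then show ?thesis
    unfolding arc_curve_def by blast
qed

lemma bounded_curves_arc_translate: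
  "bounded_curves \<B> \<Longrightarrow> B \<in> translate_curve v ` \<B> \<Longrightarrow> arc_curve B"
  using bounded_curves_arc by auto

lemma bounded_curves_segments:
  assumes "bounded_curves \<B>"
  shows "finite (segments \<B>)"
  using assms finite_ran unfolding segments_def bounded_curves_def by blast

lemma bounded_curves_translate:
  assumes "bounded_curves \<B>" "v \<in> gauss_ints"
  shows "bounded_curves (translate_curve v ` \<B>)"
proof -
  have dom: "dom (translate_curve v B) = dom B" for B
    by (auto simp: translate_curve_eq dom_def)
  have *: "curve_of I a (translate_curve v B)" if "curve_of I a B" for I a B
    unfolding curve_of_def dom
  proof (intro conjI allI impI)
    show "dom B = I" "k \<in> I \<and> k + 1 \<in> I \<Longrightarrow> a k \<in> {1, -1}" for k
      using that unfolding curve_of_def by blast+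
    fix k x e assume "translate_curve v B k = Some (x, e)"
    then obtain y where y: "x = y + v" "B k = Some (y, e)"
      by (auto simp: translate_curve_eq shift_oseg_def)
    then have "y \<in> gauss_ints" "e \<in> {1, -1, \<i>, -\<i>}"
      using that unfolding curve_of_def by blast+
    then show "x \<in> gauss_ints" "e \<in> {1, -1, \<i>, -\<i>}"
      using gauss_ints_add assms(2) y by auto
  next
    fix k x e x' e'
    assume "translate_curve v B k = Some (x, e) \<and> translate_curve v B (k + 1) = Some (x', e')"
    then obtain y y' where "x = y + v" "x' = y' + v" "B k = Some (y, e)" "B (k + 1) = Some (y', e')"
      by (auto simp: translate_curve_eq shift_oseg_def)
    moreover then have "y + e = y' \<and> e' = \<i> powi a k * e"
      using that unfolding curve_of_def by blast
    ultimately show "x + e = x'" "e' = \<i> powi a k * e"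
      by auto
  qed
  have "is_curve (translate_curve v B)" if "is_curve B" for B
    using that unfolding is_curve_def by (elim exE conjE) (intro exI conjI, assumption, rule *)
  then show ?thesis
    using assms(1) by (auto simp: bounded_curves_def dom)
qed

lemma cong_curves_translate: "cong_curves \<B> (translate_curve v ` \<B>)"
  unfolding cong_curves_def same_curves_def by blast

text \<open>A set congruent to \<open>\<B>\<close> equals a translate of \<open>\<B>\<close> up to
  shifts, and shifts affect neither \<open>local_less\<close> nor the set of segments. What remains
  is expressed by \<open>nxt\<close> and translation vectors, the form in which it passes to
  limits.\<close>

lemma local_isomorphism_property_iff:
  assumes "covering \<C>"
  shows "local_isomorphism_property \<C> \<longleftrightarrow>
    (\<forall>\<B>. bounded_curves \<B> \<and> local_less \<B> (nxt \<C>) \<longrightarrow>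
      (\<exists>r>0. \<forall>w. \<exists>v. local_less (translate_curve v ` \<B>) (nxt \<C>) \<and>
         shift_oseg v ` segments \<B> \<subseteq> {s. support s \<subseteq> cball w r}))"
proof -
  have "(\<exists>\<B>'. less_curves \<B>' \<C> \<and> cong_curves \<B> \<B>' \<and> contained_in \<B>' (cball w r)) \<longleftrightarrow>
      (\<exists>v. local_less (translate_curve v ` \<B>) (nxt \<C>) \<and>
         shift_oseg v ` segments \<B> \<subseteq> {s. support s \<subseteq> cball w r})"
    if "bounded_curves \<B>" for \<B> w r
  proof
    assume "\<exists>\<B>'. less_curves \<B>' \<C> \<and> cong_curves \<B> \<B>' \<and> contained_in \<B>' (cball w r)"
    then obtain \<B>' v where B': "less_curves \<B>' \<C>" "contained_in \<B>' (cball w r)"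
      and v: "same_curves (translate_curve v ` \<B>) \<B>'"
      unfolding cong_curves_def by blast
    have "arc_curve B" if "B \<in> \<B>'" for B
    proof -
      obtain A m where "A \<in> translate_curve v ` \<B>" "\<And>k. B k = A (k + m)"
        using same_curves_shift[OF same_curves_sym[OF v] \<open>B \<in> \<B>'\<close>] by blast
      moreover then have "arc_curve A"
        using bounded_curves_arc[OF \<open>bounded_curves \<B>\<close>] by auto
      ultimately show ?thesis
        using arc_curve_shift by blast
    qed
    then have "local_less \<B>' (nxt \<C>)"
      using less_curves_iff[OF assms] B'(1) by blast
    then have "local_less (translate_curve v ` \<B>) (nxt \<C>)"
      by (rule local_less_same_curves[OF v])
    moreover have "shift_oseg v ` segments \<B> = segments \<B>'"
      using same_curves_segments[OF v] by (simp add: segments_translate)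
    ultimately show "\<exists>v. local_less (translate_curve v ` \<B>) (nxt \<C>) \<and>
         shift_oseg v ` segments \<B> \<subseteq> {s. support s \<subseteq> cball w r}"
      using B'(2) unfolding contained_in_def by blast
  next
    assume "\<exists>v. local_less (translate_curve v ` \<B>) (nxt \<C>) \<and>
         shift_oseg v ` segments \<B> \<subseteq> {s. support s \<subseteq> cball w r}"
    then obtain v where v: "local_less (translate_curve v ` \<B>) (nxt \<C>)"
      "contained_in (translate_curve v ` \<B>) (cball w r)"
      unfolding contained_in_def segments_translate by blast
    have "less_curves (translate_curve v ` \<B>) \<C>"
      using less_curves_iff[OF assms bounded_curves_arc_translate[OF that]] v(1) by simp
    then show "\<exists>\<B>'. less_curves \<B>' \<C> \<and> cong_curves \<B> \<B>' \<and> contained_in \<B>' (cball w r)"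
      using v(2) cong_curves_translate by blast
  qed
  moreover have "less_curves \<B> \<C> \<longleftrightarrow> local_less \<B> (nxt \<C>)" if "bounded_curves \<B>" for \<B>
    using less_curves_iff[OF assms] bounded_curves_arc[OF that] by blast
  ultimately show ?thesis
    unfolding local_isomorphism_property_def by (simp cong: conj_cong)
qed

text \<open>Thus one approximant can be required to agree with the limit on all segments in a given
  disc.\<close>

lemma finite_osegs_cball: "finite {s \<in> osegs. support s \<subseteq> cball w r}"
proof -
  define X where "X = {\<lceil>Re w - r\<rceil>..\<lfloor>Re w + r\<rfloor>}"
  define Y where "Y = {\<lceil>Im w - r\<rceil>..\<lfloor>Im w + r\<rfloor>}"
  have "gauss_ints \<inter> cball w r \<subseteq> (\<lambda>(x, y). of_int x + \<i> * of_int y) ` (X \<times> Y)"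
  proof
    fix z assume z: "z \<in> gauss_ints \<inter> cball w r"
    then obtain x y :: int where xy: "z = of_int x + \<i> * of_int y"
      using gauss_ints_iff by blast
    have "cmod (z - w) \<le> r"
      using z by (simp add: dist_norm norm_minus_commute)
    then have "\<bar>Re z - Re w\<bar> \<le> r" "\<bar>Im z - Im w\<bar> \<le> r"
      using abs_Re_le_cmod[of "z - w"] abs_Im_le_cmod[of "z - w"] by simp_all
    then have "x \<in> X" "y \<in> Y"
      unfolding X_def Y_def xy by (simp_all add: ceiling_le_iff le_floor_iff abs_le_iff)
    then show "z \<in> (\<lambda>(x, y). of_int x + \<i> * of_int y) ` (X \<times> Y)"
      unfolding xy by (intro image_eqI[where x = "(x, y)"]) simp_all
  qed
  then have fin: "finite (gauss_ints \<inter> cball w r)"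
    by (rule finite_subset) (simp add: X_def Y_def)
  have "{s \<in> osegs. support s \<subseteq> cball w r} \<subseteq> (gauss_ints \<inter> cball w r) \<times> {1, -1, \<i>, -\<i>}"
    by (auto simp: osegs_def support_def)
  then show ?thesis
    by (rule finite_subset) (simp add: fin)
qed

section \<open>The limit of recentred copies of the given covering\<close>

context
  fixes \<C> :: "curve set" and x :: "nat \<Rightarrow> complex" and g :: "oseg \<Rightarrow> oseg option"
  assumes cov: "covering \<C>" and lip: "local_isomorphism_property \<C>"
    and x: "\<And>n. x n \<in> gauss_ints"
    and flows: "\<And>n. flow (shift_flow (- x n) (nxt \<C>))" and g: "flow g"
    and lim: "\<And>F. finite F \<Longrightarrow> infinite {n. \<forall>s\<in>F. shift_flow (- x n) (nxt \<C>) s = g s}"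
begin

lemma limit_agrees:
  assumes "finite F"
  obtains m where "n \<le> m" "\<And>s. s \<in> F \<Longrightarrow> shift_flow (- x m) (nxt \<C>) s = g s"
proof -
  obtain m where "n \<le> m" "m \<in> {n. \<forall>s\<in>F. shift_flow (- x n) (nxt \<C>) s = g s}"
    using lim[OF assms] unfolding infinite_nat_iff_unbounded_le by blast
  then show ?thesis
    using that by blast
qed

text \<open>The radius is chosen before the disc and the approximant. A copy of the pattern in the
  disc about \<open>w + x m\<close> becomes, after recentring, a copy in the disc about
  \<open>w\<close>, where the approximant agrees with \<open>g\<close>.\<close>

lemma limit_repetitive:
  assumes \<B>: "bounded_curves \<B>" "local_less \<B> (nxt \<C>)"
  shows "\<exists>r>0. \<forall>w. \<exists>v. local_less (translate_curve v ` \<B>) g \<and>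
         shift_oseg v ` segments \<B> \<subseteq> {s. support s \<subseteq> cball w r}"
proof -
  obtain r where r: "0 < r" "\<And>w. \<exists>v. local_less (translate_curve v ` \<B>) (nxt \<C>) \<and>
         shift_oseg v ` segments \<B> \<subseteq> {s. support s \<subseteq> cball w r}"
    using lip \<B> unfolding local_isomorphism_property_iff[OF cov] by blast
  have "\<exists>v. local_less (translate_curve v ` \<B>) g \<and>
         shift_oseg v ` segments \<B> \<subseteq> {s. support s \<subseteq> cball w r}" for w
  proof -
    obtain m where m: "\<And>s. s \<in> {s \<in> osegs. support s \<subseteq> cball w r} \<Longrightarrow> shift_flow (- x m) (nxt \<C>) s = g s"
      using limit_agrees[OF finite_osegs_cball, where n = 0] by metis
    obtain v where v: "local_less (translate_curve v ` \<B>) (nxt \<C>)"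
      "\<And>s. s \<in> segments \<B> \<Longrightarrow> support (shift_oseg v s) \<subseteq> cball (w + x m) r"
      using r(2)[of "w + x m"] by blast
    have less: "local_less (translate_curve (v - x m) ` \<B>) (shift_flow (- x m) (nxt \<C>))"
      using v(1) local_less_translate[of "- x m" "translate_curve v ` \<B>"] by (simp add: image_image)
    have sup: "support (shift_oseg (v - x m) s) \<subseteq> cball w r" if "s \<in> segments \<B>" for s
    proof -
      have "support (shift_oseg (v - x m) s) = (+) (- x m) ` support (shift_oseg v s)"
        unfolding support_def closed_segment_translation[symmetric] by (simp add: algebra_simps)
      also have "\<dots> \<subseteq> (+) (- x m) ` cball (w + x m) r"
        using v(2)[OF that] by blast
      also have "\<dots> = cball w r"
        using cball_translation[of "- x m" "w + x m" r] by simp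
      finally show ?thesis .
    qed
    have "segments (translate_curve (v - x m) ` \<B>) \<subseteq> osegs"
    proof
      fix s assume "s \<in> segments (translate_curve (v - x m) ` \<B>)"
      then have "s \<in> dom (shift_flow (- x m) (nxt \<C>))"
        using less unfolding local_less_def by (elim segmentsE) blast
      then show "s \<in> osegs"
        using flow.dom_osegs[OF flows] by blast
    qed
    then have "shift_flow (- x m) (nxt \<C>) s = g s" if "s \<in> segments (translate_curve (v - x m) ` \<B>)" for s
      using m sup that unfolding segments_translate by blast
    then have "local_less (translate_curve (v - x m) ` \<B>) g"
      using less local_less_cong by blast
    then show ?thesis
      using sup by blast
  qed
  then show ?thesis
    using r(1) by blast
qed

text \<open>The finitely many values of \<open>g\<close> that matter are those of some approximant,
  which is a translate of \<open>nxt \<C>\<close>.\<close>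

lemma limit_pattern:
  assumes \<B>: "bounded_curves \<B>" "local_less \<B> g"
  shows "\<exists>v\<in>gauss_ints. local_less (translate_curve v ` \<B>) (nxt \<C>)"
proof -
  obtain m where "\<And>s. s \<in> segments \<B> \<Longrightarrow> shift_flow (- x m) (nxt \<C>) s = g s"
    using limit_agrees[OF bounded_curves_segments[OF \<B>(1)], where n = 0] by metis
  then have "local_less \<B> (shift_flow (- x m) (nxt \<C>))"
    using \<B>(2) local_less_cong by metis
  then have "local_less (translate_curve (x m) ` \<B>) (shift_flow (x m) (shift_flow (- x m) (nxt \<C>)))"
    using local_less_translate by blast
  then show ?thesis
    using x by auto
qed

text \<open>Recurrence is inherited through \<open>\<C>\<close>: a pattern of \<open>g\<close> is a
  translate of a pattern of \<open>\<C>\<close>, and by \<open>limit_repetitive\<close> the latter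
  recurs in every disc of one radius in \<open>g\<close>.\<close>

lemma limit_folding_covering: "folding_covering (flow.curves g)"
  unfolding folding_covering_def
proof (intro conjI ballI)
  note cov' = flow.covering_curves[OF g]
  show "covering (flow.curves g)"
    by (rule cov')
  show "complete_folding_curve C" if "C \<in> flow.curves g" for C
    using flow.complete_folding_curves[OF g that] .
  show "local_isomorphism_property (flow.curves g)"
    unfolding local_isomorphism_property_iff[OF cov'] flow.nxt_curves[OF g]
  proof (intro allI impI, elim conjE)
    fix \<B> assume \<B>: "bounded_curves \<B>" "local_less \<B> g"
    then obtain u where u: "u \<in> gauss_ints" "local_less (translate_curve u ` \<B>) (nxt \<C>)"
      using limit_pattern by blast
    obtain r where r: "0 < r" "\<And>w. \<exists>v. local_less (translate_curve v ` translate_curve u ` \<B>) g \<and>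
         shift_oseg v ` segments (translate_curve u ` \<B>) \<subseteq> {s. support s \<subseteq> cball w r}"
      using limit_repetitive[OF bounded_curves_translate[OF \<B>(1) u(1)] u(2)] by blast
    have "\<exists>v. local_less (translate_curve v ` \<B>) g \<and>
        shift_oseg v ` segments \<B> \<subseteq> {s. support s \<subseteq> cball w r}" for w
      using r(2)[of w] unfolding segments_translate image_image translate_curve_translate
        shift_oseg_simps by blast
    then show "\<exists>r>0. \<forall>w. \<exists>v. local_less (translate_curve v ` \<B>) g \<and>
        shift_oseg v ` segments \<B> \<subseteq> {s. support s \<subseteq> cball w r}"
      using r(1) by blast
  qed
qed

lemma limit_locally_isomorphic: "locally_isomorphic \<C> (flow.curves g)"
proof -
  note cov' = flow.covering_curves[OF g]
  have iff: "less_curves \<B> \<C> \<longleftrightarrow> local_less \<B> (nxt \<C>)" "less_curves \<B> (flow.curves g) \<longleftrightarrow> local_less \<B> g"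
    "less_curves (translate_curve v ` \<B>) \<C> \<longleftrightarrow> local_less (translate_curve v ` \<B>) (nxt \<C>)"
    "less_curves (translate_curve v ` \<B>) (flow.curves g) \<longleftrightarrow> local_less (translate_curve v ` \<B>) g"
    if "bounded_curves \<B>" for \<B> v
    using less_curves_iff[OF cov bounded_curves_arc[OF that]]
      less_curves_iff[OF cov' bounded_curves_arc[OF that]]
      less_curves_iff[OF cov bounded_curves_arc_translate[OF that]]
      less_curves_iff[OF cov' bounded_curves_arc_translate[OF that]]
    by (simp_all add: flow.nxt_curves[OF g])
  show ?thesis
    unfolding locally_isomorphic_def
  proof (intro conjI allI impI; elim conjE)
    fix \<B> assume \<B>: "bounded_curves \<B>" "less_curves \<B> \<C>"
    then have "\<exists>v. local_less (translate_curve v ` \<B>) g"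
      using limit_repetitive[of \<B>] iff(1) by blast
    then show "\<exists>\<B>'. less_curves \<B>' (flow.curves g) \<and> cong_curves \<B> \<B>'"
      using iff(4)[OF \<B>(1)] cong_curves_translate by blast
  next
    fix \<B> assume \<B>: "bounded_curves \<B>" "less_curves \<B> (flow.curves g)"
    then have "\<exists>v. local_less (translate_curve v ` \<B>) (nxt \<C>)"
      using limit_pattern[of \<B>] iff(2) by blast
    then show "\<exists>\<B>'. less_curves \<B>' \<C> \<and> cong_curves \<B> \<B>'"
      using iff(3)[OF \<B>(1)] cong_curves_translate by blast
  qed
qed

text \<open>\<open>D\<close> is the orbit of \<open>g\<close> along an edge leaving the origin. On
  every initial stretch it coincides with a walk along some \<open>S m\<close>; the other three
  walks from that point are its rotations, and \<open>g\<close> traces each of them forwards or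
  backwards.\<close>

lemma limit_generated:
  assumes S: "\<And>n. folding n (S n)"
    and four: "\<And>n e. e \<in> {1, -1, \<i>, -\<i>} \<Longrightarrow> traced (nxt \<C>) (walk (x n) e ((!) (S n))) (2 ^ n - 1)"
  shows "\<exists>D. generated_by (flow.curves g) D"
proof -
  interpret flow g by (rule g)
  obtain b where b: "oriented (dom g) b"
    using orientation by blast
  have "{s \<in> dom g. fst s = 0 \<or> fst s + snd s = 0} = (if b then horizontal_out 0 else vertical_out 0)"
    using b[unfolded oriented_def Let_def, rule_format, of 0 0] by simp
  moreover have "(0, 1) \<in> horizontal_out 0" "(0, \<i>) \<in> vertical_out 0"
    by (auto simp: horizontal_out_def vertical_out_def)
  ultimately have "(0, 1) \<in> dom g \<or> (0, \<i>) \<in> dom g"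
    by (metis (mono_tags, lifting) mem_Collect_eq)
  \<comment> \<open>An outgoing edge in direction 1 or \<i>, the form to which
    \<open>oriented_edge\<close> applies.\<close>
  then obtain e where e: "e \<in> {1, \<i>}" "(0, e) \<in> dom g"
    by blast
  obtain c where c: "line c" "c 0 = (0, e)"
    using ex_line[OF e(2)] by blast
  define p where "p = (\<lambda>i. c (int i))"
  define q where "q = (\<lambda>(j::nat) i. (\<i> ^ j * fst (p i), \<i> ^ j * snd (p i)))"
  have p: "g (p i) = Some (p (Suc i))" "p 0 = (0, e)" for i
    using c unfolding line_def p_def by (metis of_nat_Suc add.commute, simp)
  have approx: "\<exists>m\<ge>K. (\<forall>i\<le>K. p i = walk 0 e ((!) (S m)) i) \<and> (\<forall>j<4. traced g (q j) K)"
    if "0 < K" for K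
  proof -
    \<comment> \<open>Reversed segments are included because the direction in which a rotated copy
      is traced is not known beforehand.\<close>
    define F where "F = (\<Union>j<4. \<Union>i\<le>K. {q j i, oseg_reverse (q j i)})"
    have F: "q j i \<in> F" "oseg_reverse (q j i) \<in> F" if "j < 4" "i \<le> K" for j i
      using that by (auto simp: F_def)
    have "finite F"
      by (simp add: F_def)
    then obtain m where m: "K \<le> m" "\<And>s. s \<in> F \<Longrightarrow> shift_flow (- x m) (nxt \<C>) s = g s"
      by (rule limit_agrees) blast
    define h where "h = shift_flow (- x m) (nxt \<C>)"
    interpret h: flow h
      unfolding h_def by (rule flows)
    have "K < 2 ^ K"
      by (rule less_exp)
    also have "(2::nat) ^ K \<le> 2 ^ m"
      using m(1) by simp
    finally have K: "K \<le> 2 ^ m - 1"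
      by simp
    have tr: "traced h (walk 0 u ((!) (S m))) K" if "u \<in> {1, -1, \<i>, -\<i>}" for u
    proof -
      have "(\<lambda>i. shift_oseg (- x m) (walk (x m) u ((!) (S m)) i)) = walk 0 u ((!) (S m))"
        using walk_shift[of "x m" "- x m"] by (intro ext) simp
      then have "traced h (walk 0 u ((!) (S m))) (2 ^ m - 1)"
        using four[OF that, of m] traced_shift[of "- x m" "nxt \<C>"] unfolding h_def by metis
      then show ?thesis
        using K unfolding traced_def follows_def by (meson less_le_trans)
    qed
    have q0: "q 0 i = p i" for i
      by (simp add: q_def)
    have hp: "h (p i) = Some (p (Suc i))" if "i \<le> K" for i
      using m(2) F(1)[of 0 i] that p by (simp add: h_def q0)
    \<comment> \<open>Tracing backwards would put both orientations of the edge from 0 to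
      \<open>e\<close> into \<open>dom h\<close>.\<close>
    have "follows h (walk 0 e ((!) (S m))) K"
    proof (rule ccontr)
      assume "\<not> follows h (walk 0 e ((!) (S m))) K"
      moreover have "traced h (walk 0 e ((!) (S m))) K"
        using tr e(1) by blast
      ultimately have "h (oseg_reverse (walk 0 e ((!) (S m)) (Suc 0))) = Some (oseg_reverse (walk 0 e ((!) (S m)) 0))"
        using that unfolding traced_def by blast
      then have "(0 + e, - e) \<in> dom h"
        using h.step by (force simp: oseg_reverse_def)
      moreover have "(0, e) \<in> dom h"
        using hp[of 0] p(2) by auto
      moreover have "0 \<in> gauss_ints"
        by (simp add: gauss_ints_def)
      ultimately show False
        using h.orientation oriented_edge e(1) by blast
    qed
    have walk_p: "p i = walk 0 e ((!) (S m)) i" if "i \<le> K" for i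
      using that
    proof (induction i)
      case (Suc i)
      then have "Some (p (Suc i)) = h (walk 0 e ((!) (S m)) i)"
        using hp[of i] by simp
      also have "\<dots> = Some (walk 0 e ((!) (S m)) (Suc i))"
        using \<open>follows h _ K\<close> Suc.prems by (simp add: follows_def del: walk.simps)
      finally show ?case
        by simp
    qed (simp add: p)
    moreover have "traced g (q j) K" if "j < 4" for j
    proof -
      have "\<i> ^ j * e \<in> {1, -1, \<i>, -\<i>}"
        using that e(1) by (auto simp: less_Suc_eq eval_nat_numeral)
      moreover have "walk 0 (\<i> ^ j * e) ((!) (S m)) i = q j i" if "i \<le> K" for i
        using walk_p[OF that] by (simp add: walk_rotate q_def)
      ultimately have "traced h (q j) K"
        using tr unfolding traced_def follows_def by (metis Suc_leI less_imp_le_nat)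
      moreover have "h (q j i) = g (q j i)" "h (oseg_reverse (q j i)) = g (oseg_reverse (q j i))" if "i \<le> K" for i
        using m(2) F \<open>j < 4\<close> that by (simp_all add: h_def)
      ultimately show ?thesis
        unfolding traced_def follows_def by (metis Suc_leI less_imp_le_nat)
    qed
    ultimately show ?thesis
      using m(1) by blast
  qed
  have joins: "joins (p i) (p (Suc i))" "p i \<in> osegs" for i
    using step[OF p(1)[of i]] dom_osegs p(1)[of i] by blast+
  \<comment> \<open>\<open>c\<close> starts at the origin with index 0 and \<open>D\<close> with
    index 1; so \<open>a k\<close> is the turn between \<open>D k\<close> and
    \<open>D (k + 1)\<close>.\<close>
  define a where "a = (\<lambda>k. turn (c (k - 1)) (c k))"
  define D where "D = (\<lambda>k. if 1 \<le> k then Some (c (k - 1)) else None)"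
  have D_p: "D (1 + int i) = Some (p i)" for i
    by (simp add: D_def p_def)
  have dom_D: "dom D = {1..}"
    by (auto simp: D_def split: if_splits)
  have "infinity_folding a"
    unfolding infinity_folding_def
  proof
    fix n
    obtain m where m: "2 ^ n \<le> m" "\<forall>i\<le>2 ^ n. p i = walk 0 e ((!) (S m)) i"
      using approx[of "2 ^ n"] by auto
    have "n \<le> m"
      using m(1) less_exp[of n] by linarith
    then have "(2::nat) ^ n \<le> 2 ^ m"
      by simp
    then have le: "2 ^ n - 1 \<le> length (S m)"
      unfolding length_folding[OF S[of m]] by (rule diff_le_mono)
    have "a (1 + int i) = S m ! i" if "i < 2 ^ n - 1" for i
    proof -
      have "a (1 + int i) = turn (p i) (p (Suc i))"
        by (simp add: a_def p_def add.commute)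
      also have "\<dots> = S m ! i"
      proof (rule turn_eqI)
        have "i \<le> 2 ^ n" "Suc i \<le> 2 ^ n"
          using that by auto
        then show "snd (p (Suc i)) = \<i> powi (S m ! i) * snd (p i)"
          using m(2) by simp
        show "snd (p i) \<noteq> 0"
          using joins(2)[of i] by (auto simp: osegs_def)
        show "S m ! i \<in> {1, -1}"
          using folding_set[OF S[of m]] that le by (meson less_le_trans nth_mem subsetD)
      qed
      finally show ?thesis .
    qed
    then have "map a [1..int N] = take N (S m)" if "N = 2 ^ n - 1" for N
      using le unfolding that[symmetric] by (intro nth_equalityI) (simp_all add: nth_upto)
    moreover have "int (2 ^ n - 1) = 2 ^ n - 1"
      by (simp add: of_nat_diff)
    ultimately have "map a [1..2 ^ n - 1] = take (2 ^ n - 1) (S m)"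
      by metis
    then show "folding n (map a [1..2 ^ n - 1])"
      using folding_take[OF S \<open>n \<le> m\<close>] by simp
  qed
  moreover have "curve_of {1..} a D"
    unfolding curve_of_def
  proof (intro conjI allI impI)
    show "a k \<in> {1, -1}" for k
      by (simp add: a_def turn_def)
    fix k y f assume "D k = Some (y, f)"
    then have "c (k - 1) = (y, f)"
      by (simp add: D_def split: if_splits)
    moreover have "c (k - 1) \<in> osegs"
      using c(1) dom_osegs unfolding line_def by blast
    ultimately have "(y, f) \<in> osegs"
      by simp
    then show "y \<in> gauss_ints" "f \<in> {1, -1, \<i>, -\<i>}"
      by (auto simp: osegs_def)
  next
    fix k y f y' f' assume "D k = Some (y, f) \<and> D (k + 1) = Some (y', f')"
    then have yf: "c (k - 1) = (y, f)" "c k = (y', f')"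
      by (auto simp: D_def split: if_splits)
    have "g (c (k - 1)) = Some (c k)"
      using c(1) unfolding line_def by (metis diff_add_cancel)
    then have "joins (y, f) (y', f')"
      using step yf by simp
    then show "y + f = y'" "f' = \<i> powi a k * f"
      using joins_turn[of "(y, f)" "(y', f')"] by (auto simp: joins_def a_def yf)
  qed (use dom_D in auto)
  ultimately have "infinity_folding_curve D"
    unfolding infinity_folding_curve_def by blast
  moreover have "\<exists>C\<in>curves. subcurve (rotate_curve j 0 D) C \<or> subcurve (reverse_curve (rotate_curve j 0 D)) C"
    if "j < 4" for j
  proof -
    have rot: "rotate_curve j 0 D k = (if 1 \<le> k then Some (q j (nat (k - 1))) else None)" for k
      by (simp add: rotate_curve_def D_def q_def p_def case_prod_beta')
    have "traced g (q j) (Suc K)" for K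
      using approx[of "Suc K"] that by auto
    \<comment> \<open>The direction does not depend on the length: if the forward rule failed at one
      index and the backward rule at another, no stretch containing both could be traced.\<close>
    then consider "\<And>i. g (q j i) = Some (q j (Suc i))"
      | "\<And>i. g (oseg_reverse (q j (Suc i))) = Some (oseg_reverse (q j i))"
      unfolding traced_def follows_def by (metis less_Suc_eq linorder_less_linear)
    then show ?thesis
    proof cases
      case 1
      then obtain C k where C: "C \<in> curves" "C k = Some (q j 0)"
        using ex_curve[of "q j 0"] by blast
      have Ck: "C (k + int i) = Some (q j i)" for i
        using follows_nxt_curve[of curves C k "q j" i i] covering_curves C
        by (simp add: nxt_curves follows_def 1)
      have "C (l + (k - 1)) = rotate_curve j 0 D l" if "l \<in> dom (rotate_curve j 0 D)" for l
        using Ck[of "nat (l - 1)"] that by (auto simp: rot algebra_simps split: if_splits)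
      then show ?thesis
        using C(1) unfolding subcurve_def by blast
    next
      case 2
      have "oseg_reverse (q j 0) \<in> dom g"
        using step[OF 2] by blast
      then obtain C k where C: "C \<in> curves" "C k = Some (oseg_reverse (q j 0))"
        using ex_curve by blast
      obtain d where d: "line d" "C = Some \<circ> d"
        using C(1) by (rule curvesE)
      have Ck: "d (k - int i) = oseg_reverse (q j i)" for i
      proof (induction i)
        case (Suc i)
        have "g (d (k - int (Suc i))) = Some (d (k - int i))"
          using d(1) unfolding line_def by (metis add_diff_eq diff_diff_eq2 of_nat_Suc diff_add_cancel add.commute)
        then show ?case
          using 2[of i] inj Suc by metis
      qed (use C d in simp)
      \<comment> \<open>\<open>reverse_curve\<close> places the reversed initial segment at index
        -1, and in \<open>C\<close> it has index \<open>k\<close>; hence the offset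
        \<open>k + 1\<close>.\<close>
      have "C (l + (k + 1)) = reverse_curve (rotate_curve j 0 D) l"
        if "l \<in> dom (reverse_curve (rotate_curve j 0 D))" for l
      proof -
        have l: "l \<le> - 1"
          using that by (auto simp: reverse_curve_def rot split: if_splits)
        define i where "i = nat (- l - 1)"
        have i: "l + (k + 1) = k - int i" "nat (- l - 1) = i"
          using l by (simp_all add: i_def)
        show ?thesis
          unfolding i(1) using Ck[of i] l i(2) by (simp add: d reverse_curve_def rot)
      qed
      then show ?thesis
        using C(1) unfolding subcurve_def by blast
    qed
  qed
  moreover have "D 1 = Some (0, e)"
    by (simp add: D_def c)
  ultimately show ?thesis
    using limit_folding_covering unfolding generated_by_def by blast
qed

end

theorem theorem4:
  fixes \<C> :: "curve set"
  assumes "covering \<C>"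
    and "\<forall>C\<in>\<C>. complete_folding_curve C"
    and "local_isomorphism_property \<C>"
  shows "\<exists>\<D> D. generated_by \<D> D \<and> locally_isomorphic \<C> \<D>"
proof -
  obtain x S where x: "\<And>n. x n \<in> gauss_ints" and S: "\<And>n. folding n (S n)"
    and four: "\<And>n e. e \<in> {1, -1, \<i>, -\<i>} \<Longrightarrow> traced (nxt \<C>) (walk (x n) e ((!) (S n))) (2 ^ n - 1)"
    using ex_fourfold_point[OF assms(1,2)] by metis
  have flows: "flow (shift_flow (- x n) (nxt \<C>))" for n
    by (intro flow_shift covering_flow[OF assms(1,2)] gauss_ints_minus x)
  then obtain g where "flow g"
    "\<And>F. finite F \<Longrightarrow> infinite {n. \<forall>s\<in>F. shift_flow (- x n) (nxt \<C>) s = g s}"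
    using flow_sequence_limit[of "\<lambda>n. shift_flow (- x n) (nxt \<C>)"] by blast
  note limit = assms(1,3) x flows this
  obtain D where "generated_by (flow.curves g) D"
    using limit_generated[OF limit S four] by blast
  then show ?thesis
    using limit_locally_isomorphic[OF limit] by blast
qed

end
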